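(* Let $d\ge1$, $f\in L^\infty(\mathbb{R}_+^d)$, $\alpha\in(-\tfrac12,\infty)^d$ and $\beta>0$. Then for any two integers $k$ and $l$ both greater than $\beta$, the following two conditions are equivalent: (a) there is a constant $A_{\beta,k}$ such that $\big\|\frac{\partial^kP_t^\alpha f}{\partial t^k}\big\|_\infty\le A_{\beta,k}\,t^{-k+\beta}$ for all $t>0$; (b) there is a constant $A_{\beta,l}$ such that $\big\|\frac{\partial^lP_t^\alpha f}{\partial t^l}\big\|_\infty\le A_{\beta,l}\,t^{-l+\beta}$ for all $t>0$. Furthermore, the smallest constants $A_{\beta,k}$ and $A_{\beta,l}$ satisfying these inequalities are comparable (each is bounded by a constant multiple of the other, with constants independent of $f$).
   Context: Let $\mathbb{R}_+^d=(0,\infty)^d$ and, for $\alpha=(\alpha_1,\dots,\alpha_d)\in(-1,\infty)^d$, let $\mathrm{d}\mu_\alpha(x)=\prod_{i=1}^d\frac{x_i^{\alpha_i}e^{-x_i}}{\Gamma(\alpha_i+1)}\,\mathrm{d}x$ be the Laguerre measure on $\mathbb{R}_+^d$. The Laguerre operator $\mathcal{L}^\alpha=-\sum_{i=1}^d\big[x_i\partial_{x_i}^2+(\alpha_i+1-x_i)\partial_{x_i}\big]$ is positive and self-adjoint (after closure) in $L^2(\mathbb{R}_+^d,\mathrm{d}\mu_\alpha)$. Laguerre semigroup: $T_t^\alpha=e^{-t\mathcal{L}^\alpha}$, given for $t>0$ by $T_t^\alpha f(x)=\int_{\mathbb{R}_+^d}G_t^\alpha(x,y)f(y)\,\mathrm{d}\mu_\alpha(y)$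 with $$G_t^\alpha(x,y)=\prod_{j=1}^d\frac{\Gamma(\alpha_j+1)}{1-e^{-t}}\,e^{-\frac{e^{-t}}{1-e^{-t}}(x_j+y_j)}\big(\sqrt{e^{-t}x_jy_j}\big)^{-\alpha_j}I_{\alpha_j}\Big(\frac{2\sqrt{e^{-t}x_jy_j}}{1-e^{-t}}\Big),$$ where $I_\nu$ is the modified Bessel function of the first kind of order $\nu$. Poisson-Laguerre semigroup: $P_t^\alpha=e^{-t\sqrt{\mathcal{L}^\alpha}}$, given for $t>0$ by $$P_t^\alpha f(x)=\int_0^\infty T_s^\alpha f(x)\,\frac{t}{2\sqrt\pi}\,\frac{e^{-t^2/(4s)}}{s^{3/2}}\,\mathrm{d}s .$$ *)

theory Defs
  imports "HOL-Probability.Essential_Supremum"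
begin

text \<open>Points of d-dimensional space are vectors indexed by a finite type \<open>'d\<close>; functions are
  complex-valued, which includes real-valued functions. All semigroups are evaluated pointwise
  on the open positive orthant, at positive times only.\<close>

definition orthant :: "(real^'d) set" where
  "orthant = {x. \<forall>i. 0 < x $ i}"

definition orthant_lborel :: "(real^'d) measure" where
  "orthant_lborel = restrict_space lborel orthant"

definition laguerre_measure :: "real^'d \<Rightarrow> (real^'d) measure" where
  "laguerre_measure \<alpha> = density orthant_lborel
     (\<lambda>x. ennreal (\<Prod>i\<in>UNIV. (x $ i) powr (\<alpha> $ i) * exp (- (x $ i)) / Gamma (\<alpha> $ i + 1)))"

text \<open>Modified Bessel function of the first kind, by its power series; meant for \<open>z > 0\<close>.\<close>

definition bessel_I :: "real \<Rightarrow> real \<Rightarrow> real" where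
  "bessel_I \<nu> z = (\<Sum>m. (z / 2) powr (2 * real m + \<nu>) / (fact m * Gamma (real m + \<nu> + 1)))"

definition laguerre_kernel :: "real^'d \<Rightarrow> real \<Rightarrow> real^'d \<Rightarrow> real^'d \<Rightarrow> real" where
  "laguerre_kernel \<alpha> t x y =
     (\<Prod>j\<in>UNIV. Gamma (\<alpha> $ j + 1) / (1 - exp (-t))
        * exp (- (exp (-t) / (1 - exp (-t))) * (x $ j + y $ j))
        * sqrt (exp (-t) * x $ j * y $ j) powr (- (\<alpha> $ j))
        * bessel_I (\<alpha> $ j) (2 * sqrt (exp (-t) * x $ j * y $ j) / (1 - exp (-t))))"

definition laguerre_semigroup ::
    "real^'d \<Rightarrow> real \<Rightarrow> (real^'d \<Rightarrow> complex) \<Rightarrow> real^'d \<Rightarrow> complex" where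
  "laguerre_semigroup \<alpha> t f x = (LINT y|laguerre_measure \<alpha>. laguerre_kernel \<alpha> t x y *\<^sub>R f y)"

definition poisson_laguerre ::
    "real^'d \<Rightarrow> real \<Rightarrow> (real^'d \<Rightarrow> complex) \<Rightarrow> real^'d \<Rightarrow> complex" where
  "poisson_laguerre \<alpha> t f x =
     (LINT s:{0<..}|lborel.
        (t / (2 * sqrt pi) * exp (- (t\<^sup>2 / (4 * s))) / s powr (3 / 2))
          *\<^sub>R laguerre_semigroup \<alpha> s f x)"

definition poisson_laguerre_deriv ::
    "nat \<Rightarrow> real^'d \<Rightarrow> real \<Rightarrow> (real^'d \<Rightarrow> complex) \<Rightarrow> real^'d \<Rightarrow> complex" where
  "poisson_laguerre_deriv k \<alpha> t f x =
     ((\<lambda>u s. vector_derivative u (at s)) ^^ k) (\<lambda>s. poisson_laguerre \<alpha> s f x) t"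

text \<open>Note that \<^const>\<open>esssup\<close> is infinite on non-measurable functions. The Laguerre measures
  have the same null sets as Lebesgue measure on the orthant.\<close>

definition Linf_norm :: "(real^'d \<Rightarrow> complex) \<Rightarrow> ereal" where
  "Linf_norm f = esssup orthant_lborel (\<lambda>x. ereal (norm (f x)))"

definition Linf :: "(real^'d \<Rightarrow> complex) set" where
  "Linf = {f \<in> borel_measurable orthant_lborel. Linf_norm f < \<infinity>}"

definition lipschitz_bound ::
    "real^'d \<Rightarrow> real \<Rightarrow> nat \<Rightarrow> (real^'d \<Rightarrow> complex) \<Rightarrow> real \<Rightarrow> bool" where
  "lipschitz_bound \<alpha> \<beta> k f A \<longleftrightarrow>
     (\<forall>t>0. Linf_norm (poisson_laguerre_deriv k \<alpha> t f) \<le> ereal (A * t powr (- real k + \<beta>)))"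

definition lipschitz_const ::
    "real^'d \<Rightarrow> real \<Rightarrow> nat \<Rightarrow> (real^'d \<Rightarrow> complex) \<Rightarrow> real" where
  "lipschitz_const \<alpha> \<beta> k f = (LEAST A. lipschitz_bound \<alpha> \<beta> k f A)"

end

(*
  Write P_t f = int eta_t(s) T_s f ds with the density eta_t of the 1/2-stable subordinator.

  Passing from order k to a larger order k + j uses P_{t+r} = P_t P_r: it gives
  d^{k+j}/dt^{k+j} P_{2t} f = (d^j/dt^j P_t) (d^k/dt^k P_t f), and d^j/dt^j P_t has norm O(t^{-j}) on
  L^infinity because the j-th t-derivative of eta_t has L^1 norm O(t^{-j}).  The semigroup law needs
  eta_t * eta_r = eta_{t+r}, for which an explicit antiderivative of the convolution integrand is
  available in terms of the Gauss error function, and the Chapman-Kolmogorov equation for the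
  Laguerre kernel, which is Weber's second exponential integral in each coordinate.

  Passing from order l + 1 to order l > beta is an integration from t to infinity, since the l-th
  derivative is O(t^{-l}) there.
*)

theory Submission
  imports
    Defs
    "HOL-Probability.Distributions"
    "HOL-Computational_Algebra.Formal_Power_Series"
    "HOL-Real_Asymp.Real_Asymp"
begin

section \<open>Differentiation under the integral sign\<close>

text \<open>The comparison constant must not see the size of \<open>f\<close>, so a bound
  \<open>B\<close> for \<open>f\<close> may enter only qualitatively. Going up, the function fed
  into the semigroup is the derivative at half the time, which is controlled through
  \<open>A\<close>. Going down, \<open>B\<close> survives only in a boundary term at time
  \<open>T\<close>, which vanishes as \<open>T\<close> grows; convergence of the integral of
  \<open>s powr (- real (Suc l) + \<beta>)\<close> is where \<open>real l > \<beta>\<close> enters.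

  Null sets are the obstacle. A bound on the essential supremum for each time has an exceptional set
  depending on the time, while the integration in time takes place at a fixed point. A common null
  set comes from rational times and continuity. Going up there is no such trouble: integrating
  against the kernel removes null sets, so the estimate holds at every point.

  The rate t^(-j) comes from absorbing a polynomial in t^2 / s into half of the Gaussian exponent;
  what remains is again a density of mass one, at time t / sqrt 2.

  Laguerre analysis enters only through positivity, total mass one and the Chapman-Kolmogorov
  equation of the kernel, isolated in a locale.\<close>

lemma has_vector_derivative_iff_quotient:
  fixes f :: "real \<Rightarrow> 'a::real_normed_vector"
  shows "(f has_vector_derivative d) (at t) \<longleftrightarrow> ((\<lambda>s. (f s - f t) /\<^sub>R (s - t)) \<longlongrightarrow> d) (at t)"
proof -
  have "(f has_vector_derivative d) (at t) \<longleftrightarrow>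
      ((\<lambda>s. norm (f s - f t - (s - t) *\<^sub>R d) / norm (s - t)) \<longlongrightarrow> 0) (at t)"
    by (simp add: has_vector_derivative_def has_derivative_iff_norm bounded_linear_scaleR_left)
  also have "\<dots> \<longleftrightarrow> ((\<lambda>s. norm ((f s - f t) /\<^sub>R (s - t) - d)) \<longlongrightarrow> 0) (at t)"
  proof (rule tendsto_cong, rule eventually_at_filter[THEN iffD2], rule always_eventually, intro allI impI)
    fix s assume "s \<noteq> t"
    then have "(f s - f t) /\<^sub>R (s - t) - d = (f s - f t - (s - t) *\<^sub>R d) /\<^sub>R (s - t)"
      by (simp add: scaleR_diff_right)
    then show "norm (f s - f t - (s - t) *\<^sub>R d) / norm (s - t) = norm ((f s - f t) /\<^sub>R (s - t) - d)"
      by (simp add: divide_inverse_commute)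
  qed
  also have "\<dots> \<longleftrightarrow> ((\<lambda>s. (f s - f t) /\<^sub>R (s - t)) \<longlongrightarrow> d) (at t)"
    by (simp add: tendsto_norm_zero_iff LIM_zero_iff)
  finally show ?thesis .
qed

text \<open>The mean value inequality on a ball inside \<open>T\<close> turns the bound on
  \<open>F'\<close> into a bound on the difference quotients. The limit is tested along sequences,
  where dominated convergence applies.\<close>

lemma has_vector_derivative_lebesgue_integral:
  fixes F F' :: "real \<Rightarrow> 'b \<Rightarrow> 'c::{banach, second_countable_topology}"
  assumes T: "open T" "t \<in> T"
    and int: "\<And>s. s \<in> T \<Longrightarrow> integrable M (F s)"
    and deriv: "\<And>s y. s \<in> T \<Longrightarrow> y \<in> space M \<Longrightarrow> ((\<lambda>s. F s y) has_vector_derivative F' s y) (at s)"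
    and meas: "F' t \<in> borel_measurable M"
    and bound: "\<And>s y. s \<in> T \<Longrightarrow> y \<in> space M \<Longrightarrow> norm (F' s y) \<le> g y"
    and g: "integrable M g"
  shows "((\<lambda>s. \<integral>y. F s y \<partial>M) has_vector_derivative (\<integral>y. F' t y \<partial>M)) (at t)"
proof -
  obtain e where e: "e > 0" "ball t e \<subseteq> T"
    using T open_contains_ball by blast
  have int': "integrable M (F' t)"
  proof (rule Bochner_Integration.integrable_bound[OF g meas], rule AE_I2)
    fix y assume "y \<in> space M"
    from bound[OF T(2) this] show "norm (F' t y) \<le> norm (g y)" by simp
  qed
  have lip: "norm ((F s y - F t y) /\<^sub>R (s - t)) \<le> g y" if "s \<in> ball t e" "s \<noteq> t" "y \<in> space M" for s y
  proof -
    have "norm (F s y - F t y) \<le> g y * norm (s - t)"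
    proof (rule differentiable_bound[where S="ball t e" and f'="\<lambda>x h. h *\<^sub>R F' x y"])
      fix x assume x: "x \<in> ball t e"
      show "((\<lambda>s. F s y) has_derivative (\<lambda>h. h *\<^sub>R F' x y)) (at x within ball t e)"
        using deriv[OF subsetD[OF e(2) x] that(3)] unfolding has_vector_derivative_def
        by (rule has_derivative_at_withinI)
      show "onorm (\<lambda>h. h *\<^sub>R F' x y) \<le> g y"
      proof (rule onorm_le)
        fix h :: real
        have "norm (h *\<^sub>R F' x y) \<le> norm h * g y"
          using bound[of x y] x e that by (auto intro!: mult_left_mono)
        then show "norm (h *\<^sub>R F' x y) \<le> g y * norm h" by (simp add: mult.commute)
      qed
    qed (use e that in auto)
    then show ?thesis using that by (simp add: divide_simps)
  qed
  show ?thesis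
    unfolding has_vector_derivative_iff_quotient tendsto_at_iff_sequentially
  proof (intro allI impI)
    fix X :: "nat \<Rightarrow> real" assume X: "\<forall>i. X i \<in> UNIV - {t}" "X \<longlonglongrightarrow> t"
    \<comment> \<open>Only eventually does \<open>X i\<close> lie in the ball where the quotients
      are dominated; the other indices get the limit value, so that domination by \<open>g\<close>
      holds for every \<open>i\<close>.\<close>
    define Q where "Q i y = (if X i \<in> ball t e then (F (X i) y - F t y) /\<^sub>R (X i - t) else F' t y)" for i y
    have ev: "\<forall>\<^sub>F i in sequentially. X i \<in> ball t e"
      using X(2) e(1) by (auto simp: tendsto_iff dist_commute)
    have "(\<lambda>i. \<integral>y. Q i y \<partial>M) \<longlonglongrightarrow> (\<integral>y. F' t y \<partial>M)"
    proof (rule integral_dominated_convergence[OF meas _ g])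
      show "Q i \<in> borel_measurable M" for i
        using meas borel_measurable_integrable[OF int] e T(2) unfolding Q_def
        by (cases "X i \<in> ball t e") (auto intro!: borel_measurable_scaleR borel_measurable_diff)
      show "AE y in M. (\<lambda>i. Q i y) \<longlonglongrightarrow> F' t y"
      proof (rule AE_I2)
        fix y assume y: "y \<in> space M"
        have "((\<lambda>s. (F s y - F t y) /\<^sub>R (s - t)) \<longlongrightarrow> F' t y) (at t)"
          using deriv[OF T(2) y] unfolding has_vector_derivative_iff_quotient .
        then have "(\<lambda>i. (F (X i) y - F t y) /\<^sub>R (X i - t)) \<longlonglongrightarrow> F' t y"
          using X unfolding tendsto_at_iff_sequentially comp_def by blast
        moreover have "\<forall>\<^sub>F i in sequentially. (F (X i) y - F t y) /\<^sub>R (X i - t) = Q i y"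
          using ev by eventually_elim (simp add: Q_def)
        ultimately show "(\<lambda>i. Q i y) \<longlonglongrightarrow> F' t y"
          by (rule Lim_transform_eventually)
      qed
      show "AE y in M. norm (Q i y) \<le> g y" for i
        using lip[of "X i"] X(1) bound[OF T(2)] by (intro AE_I2) (auto simp: Q_def)
    qed
    moreover have "\<forall>\<^sub>F i in sequentially.
        (\<integral>y. Q i y \<partial>M) = ((\<lambda>s. ((\<integral>y. F s y \<partial>M) - (\<integral>y. F t y \<partial>M)) /\<^sub>R (s - t)) \<circ> X) i"
      using ev
    proof eventually_elim
      case (elim i)
      then have "X i \<in> T" using e by auto
      then show ?case using elim int T(2) by (simp add: Q_def)
    qed
    ultimately show "((\<lambda>s. ((\<integral>y. F s y \<partial>M) - (\<integral>y. F t y \<partial>M)) /\<^sub>R (s - t)) \<circ> X) \<longlonglongrightarrow> (\<integral>y. F' t y \<partial>M)"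
      by (rule Lim_transform_eventually)
  qed
qed

section \<open>The subordination kernel\<close>

text \<open>This is \<open>sqrt pi / 2\<close> times the error function. The oriented integral makes
  it an odd function on the whole line, as is needed for arguments that run from minus to plus
  infinity.\<close>

definition gauss :: "real \<Rightarrow> real" where
  "gauss z = (LBINT y=0..z. exp (- y\<^sup>2))"

lemma gauss_deriv: "(gauss has_real_derivative exp (- z\<^sup>2)) (at z)"
proof -
  \<comment> \<open>The fundamental theorem yields a derivative within a compact interval; the
    margin 1 on both sides puts \<open>z\<close> in its interior.\<close>
  have "((\<lambda>u. LBINT y=0..u. exp (- y\<^sup>2)) has_vector_derivative (exp (- z\<^sup>2))) (at z within {min 0 z - 1..max 0 z + 1})"
    unfolding zero_ereal_def by (rule interval_integral_FTC2) (auto intro!: continuous_intros)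
  then have "((\<lambda>u. LBINT y=0..u. exp (- y\<^sup>2)) has_vector_derivative (exp (- z\<^sup>2))) (at z)"
    using at_within_Icc_at[of "min 0 z - 1" z "max 0 z + 1"] by simp
  then show ?thesis
    by (simp add: gauss_def[abs_def] has_real_derivative_iff_has_vector_derivative)
qed

lemma gauss_at_top: "(gauss \<longlongrightarrow> sqrt pi / 2) at_top"
proof -
  have "((\<lambda>b. \<integral>x. indicator {..b::real} x *\<^sub>R (indicator {0..} x *\<^sub>R exp (- x\<^sup>2)) \<partial>lborel) \<longlongrightarrow> (\<integral>x. indicator {0..} x *\<^sub>R exp (- x\<^sup>2) \<partial>lborel)) at_top"
    using gaussian_moment_0[unfolded has_bochner_integral_iff]
    by (intro tendsto_integral_at_top) simp_all
  moreover have "(\<integral>x. indicator {..b} x *\<^sub>R (indicator {0..} x *\<^sub>R exp (- x\<^sup>2)) \<partial>lborel) =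
      (\<integral>x. indicator {0..b} x *\<^sub>R (exp (- x\<^sup>2)) \<partial>lborel)" for b :: real
    by (intro Bochner_Integration.integral_cong) (auto simp: indicator_def)
  moreover have "(\<integral>x. indicator {0..} x *\<^sub>R exp (- x\<^sup>2) \<partial>lborel) = sqrt pi / 2"
    using gaussian_moment_0 by (rule has_bochner_integral_integral_eq)
  ultimately have "((\<lambda>b. \<integral>x. indicator {0..b} x *\<^sub>R (exp (- x\<^sup>2)) \<partial>lborel) \<longlongrightarrow> sqrt pi / 2) at_top"
    by (simp only:)
  moreover have "\<forall>\<^sub>F b in at_top. (\<integral>x. indicator {0..b} x *\<^sub>R (exp (- x\<^sup>2)) \<partial>lborel) = gauss b"
    using eventually_ge_at_top[of 0]
    unfolding gauss_def zero_ereal_def set_lebesgue_integral_def[symmetric]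
    by eventually_elim (rule interval_integral_Icc[symmetric])
  ultimately show ?thesis by (rule Lim_transform_eventually)
qed

lemma gauss_0 [simp]: "gauss 0 = 0"
  unfolding gauss_def zero_ereal_def by (rule interval_integral_endpoints_same)

lemma gauss_minus: "gauss (- z) = - gauss z"
  unfolding gauss_def
  by (subst interval_integral_reflect, subst interval_integral_endpoints_reverse) simp

lemma gauss_at_bot: "(gauss \<longlongrightarrow> - sqrt pi / 2) at_bot"
proof -
  have "((\<lambda>z. - gauss (- z)) \<longlongrightarrow> - (sqrt pi / 2)) at_bot"
    by (intro tendsto_minus filterlim_compose[OF gauss_at_top] filterlim_uminus_at_top_at_bot)
  then show ?thesis by (simp add: gauss_minus)
qed

text \<open>With \<open>q = t\<^sup>2 / s\<close>, the \<open>k\<close>-th \<open>t\<close>-derivative of \<open>t / (2 \<surd>\<pi>) s powr (-3/2) exp (- q / 4)\<close> has the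
  form \<open>t powr (1 - k) s powr (-3/2) p\<^sub>k(q) exp (- q / 4)\<close>; differentiating once more gives the recursion for
  the polynomials \<open>p\<^sub>k\<close>.\<close>

fun eta_poly :: "nat \<Rightarrow> real poly" where
  "eta_poly 0 = [:1 / (2 * sqrt pi):]"
| "eta_poly (Suc k) = smult (1 - real k) (eta_poly k) + [:0, 2:] * pderiv (eta_poly k) - [:0, 1/2:] * eta_poly k"

text \<open>Extended by zero to \<open>s \<le> 0\<close>, so that integrals and convolutions can run
  over the whole line.\<close>

definition eta :: "nat \<Rightarrow> real \<Rightarrow> real \<Rightarrow> real" where
  "eta k t s = indicator {0<..} s * (t powr (1 - real k) / (s * sqrt s) * poly (eta_poly k) (t\<^sup>2 / s) * exp (- (t\<^sup>2 / (4 * s))))"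

lemma eta_nonpos [simp]: "s \<le> 0 \<Longrightarrow> eta k t s = 0"
  by (simp add: eta_def)

lemma eta_0: "t > 0 \<Longrightarrow> s > 0 \<Longrightarrow> eta 0 t s = t / (2 * sqrt pi) / (s * sqrt s) * exp (- (t\<^sup>2 / (4 * s)))"
  by (simp add: eta_def)

lemma eta_0_nonneg: "t > 0 \<Longrightarrow> 0 \<le> eta 0 t s"
  by (cases "s > 0") (auto simp: eta_0)

lemma eta_measurable [measurable]: "eta k t \<in> borel_measurable borel"
proof -
  have [measurable]: "poly p \<in> borel_measurable borel" for p :: "real poly"
    by (intro borel_measurable_continuous_onI continuous_intros)
  show ?thesis unfolding eta_def[abs_def] by measurable
qed

lemma eta_deriv:
  assumes t: "t > 0"
  shows "((\<lambda>t. eta k t s) has_real_derivative eta (Suc k) t s) (at t)"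
proof (cases "s > 0")
  case s: True
  let ?p = "eta_poly k"
  have "((\<lambda>t. t powr (1 - real k) / (s * sqrt s) * poly ?p (t\<^sup>2 / s) * exp (- (t\<^sup>2 / (4 * s))))
      has_real_derivative
        ((1 - real k) * t powr (- real k) / (s * sqrt s) * poly ?p (t\<^sup>2 / s) * exp (- (t\<^sup>2 / (4 * s)))
         + t powr (1 - real k) / (s * sqrt s) * (poly (pderiv ?p) (t\<^sup>2 / s) * (2 * t / s)) * exp (- (t\<^sup>2 / (4 * s)))
         + t powr (1 - real k) / (s * sqrt s) * poly ?p (t\<^sup>2 / s) * (exp (- (t\<^sup>2 / (4 * s))) * (- (2 * t / (4 * s)))))) (at t)"
    using t s by (auto intro!: derivative_eq_intros DERIV_chain'[OF _ poly_DERIV] simp: divide_simps) (simp_all add: algebra_simps power2_eq_square)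
  moreover have tk: "t powr (1 - real k) = t * t powr (- real k)"
    using t by (simp add: powr_diff powr_minus_divide)
  have "(1 - real k) * t powr (- real k) / (s * sqrt s) * poly ?p (t\<^sup>2 / s) * exp (- (t\<^sup>2 / (4 * s)))
         + t powr (1 - real k) / (s * sqrt s) * (poly (pderiv ?p) (t\<^sup>2 / s) * (2 * t / s)) * exp (- (t\<^sup>2 / (4 * s)))
         + t powr (1 - real k) / (s * sqrt s) * poly ?p (t\<^sup>2 / s) * (exp (- (t\<^sup>2 / (4 * s))) * (- (2 * t / (4 * s))))
      = eta (Suc k) t s"
  proof -
    define a where "a = t powr (- real k) / (s * sqrt s)"
    define e where "e = exp (- (t\<^sup>2 / (4 * s)))"
    have "t powr (1 - real k) / (s * sqrt s) = t * a" unfolding tk a_def by simp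
    moreover have "eta (Suc k) t s = a * ((1 - real k) * poly ?p (t\<^sup>2 / s)
        + 2 * (t\<^sup>2 / s) * poly (pderiv ?p) (t\<^sup>2 / s) - (t\<^sup>2 / s) / 2 * poly ?p (t\<^sup>2 / s)) * e"
      using s by (simp add: eta_def a_def e_def)
    moreover have "(1 - real k) * t powr (- real k) / (s * sqrt s) = (1 - real k) * a" by (simp add: a_def)
    ultimately show ?thesis
      by (simp only: e_def[symmetric]) (simp add: algebra_simps power2_eq_square)
  qed
  ultimately show ?thesis using s by (simp add: eta_def)
qed simp

text \<open>Horner form: each step costs one factor \<open>q\<close>, which is at most
  \<open>2 / c * exp (c / 2 * q)\<close>, while the other half of the exponent is left for the
  remaining polynomial.\<close>

lemma poly_le_exp:
  fixes p :: "real poly"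
  assumes "c > 0"
  shows "\<exists>C>0. \<forall>q\<ge>0. \<bar>poly p q\<bar> \<le> C * exp (c * q)"
  using assms
proof (induction p arbitrary: c)
  case 0
  show ?case by (rule exI[of _ 1]) simp
next
  case (pCons a p)
  obtain C where C: "C > 0" "\<And>q. q \<ge> 0 \<Longrightarrow> \<bar>poly p q\<bar> \<le> C * exp (c / 2 * q)"
    using pCons.IH[of "c / 2"] pCons.prems by auto
  show ?case
  proof (intro exI[of _ "\<bar>a\<bar> + 2 / c * C"] conjI allI impI)
    fix q :: real assume q: "q \<ge> 0"
    have "2 / c * (c / 2 * q) \<le> 2 / c * exp (c / 2 * q)"
      using exp_ge_add_one_self[of "c / 2 * q"] pCons.prems by (intro mult_left_mono) (linarith, simp)
    then have q': "q \<le> 2 / c * exp (c / 2 * q)"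
      using pCons.prems by simp
    have "\<bar>poly (pCons a p) q\<bar> \<le> \<bar>a\<bar> + q * \<bar>poly p q\<bar>"
      using q by (simp add: abs_mult order_trans[OF abs_triangle_ineq])
    also have "\<dots> \<le> \<bar>a\<bar> * exp (c * q) + (2 / c * exp (c / 2 * q)) * (C * exp (c / 2 * q))"
      using pCons.prems q q' C by (intro add_mono mult_mono) (auto simp: mult_le_cancel_left1)
    also have "\<dots> = (\<bar>a\<bar> + 2 / c * C) * exp (c * q)"
      by (simp add: algebra_simps flip: exp_add)
    finally show "\<bar>poly (pCons a p) q\<bar> \<le> (\<bar>a\<bar> + 2 / c * C) * exp (c * q)" .
  qed (use C pCons.prems in \<open>simp add: add_nonneg_pos\<close>)
qed

text \<open>With q = t^2 / s, the polynomial is absorbed by exp (q / 8). The remaining exp (- q / 8)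
  is exactly the Gaussian factor of \<open>eta 0 (t / sqrt 2)\<close>, whose normalisation is undone
  by \<open>sqrt 2 * (2 * sqrt pi)\<close>. Comparing with a probability density gives an L^1 norm
  of order t^(-k).\<close>

lemma eta_bound_exists:
  "\<exists>C>0. \<forall>t>0. \<forall>s. \<bar>eta k t s\<bar> \<le> C * t powr (- real k) * eta 0 (t / sqrt 2) s"
proof -
  obtain C where C: "C > 0" "\<And>q. q \<ge> 0 \<Longrightarrow> \<bar>poly (eta_poly k) q\<bar> \<le> C * exp (1 / 8 * q)"
    using poly_le_exp[of "1/8"] by auto
  show ?thesis
  proof (intro exI[of _ "C * (sqrt 2 * (2 * sqrt pi))"] conjI allI impI)
    fix t s :: real assume t: "t > 0"
    show "\<bar>eta k t s\<bar> \<le> C * (sqrt 2 * (2 * sqrt pi)) * t powr (- real k) * eta 0 (t / sqrt 2) s"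
    proof (cases "s > 0")
      case s: True
      have tk: "t powr (1 - real k) = t * t powr (- real k)"
        using t by (simp add: powr_diff powr_minus_divide)
      have "\<bar>eta k t s\<bar> = t * t powr (- real k) / (s * sqrt s) * exp (- (t\<^sup>2 / (4 * s))) * \<bar>poly (eta_poly k) (t\<^sup>2 / s)\<bar>"
        using s t by (simp add: eta_def abs_mult tk)
      also have "\<dots> \<le> t * t powr (- real k) / (s * sqrt s) * exp (- (t\<^sup>2 / (4 * s))) * (C * exp (1 / 8 * (t\<^sup>2 / s)))"
        using s t by (intro mult_left_mono C(2)) simp_all
      also have "\<dots> = t * t powr (- real k) / (s * sqrt s) * C * exp (- (t\<^sup>2 / (4 * s)) + 1 / 8 * (t\<^sup>2 / s))"
        by (simp only: exp_add mult.assoc mult.left_commute mult.commute)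
      also have "- (t\<^sup>2 / (4 * s)) + 1 / 8 * (t\<^sup>2 / s) = - ((t / sqrt 2)\<^sup>2 / (4 * s))"
        using s by (simp add: field_simps)
      also have "t * t powr (- real k) / (s * sqrt s) * C * exp (- ((t / sqrt 2)\<^sup>2 / (4 * s)))
          = C * (sqrt 2 * (2 * sqrt pi)) * t powr (- real k) * eta 0 (t / sqrt 2) s"
        using s t by (simp add: eta_0 del: power_divide)
      finally show ?thesis .
    qed simp
  qed (use C in simp)
qed

text \<open>The substitution z = t / (2 sqrt s) reduces the density to a Gaussian; the
  antiderivative \<open>F\<close> rises from -1 at 0 to 0 at infinity.\<close>

lemma nn_integral_eta_0:
  assumes t: "t > 0"
  shows "(\<integral>\<^sup>+s. ennreal (eta 0 t s) \<partial>lborel) = 1"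
proof -
  define F where "F s = - (2 / sqrt pi) * gauss (t / (2 * sqrt s))" for s
  have D: "(F has_real_derivative eta 0 t s) (at s)" if "s > 0" for s
    unfolding F_def eta_0[OF t that]
    using that t
    by (auto intro!: derivative_eq_intros DERIV_chain'[OF _ gauss_deriv] simp: divide_simps power2_eq_square real_sqrt_mult)
  have cont: "isCont (eta 0 t) s" if "s > 0" for s
  proof -
    have "isCont (\<lambda>s. t / (2 * sqrt pi) / (s * sqrt s) * exp (- (t\<^sup>2 / (4 * s)))) s"
      using that by (auto intro!: continuous_intros)
    moreover have "\<forall>\<^sub>F s in nhds s. t / (2 * sqrt pi) / (s * sqrt s) * exp (- (t\<^sup>2 / (4 * s))) = eta 0 t s"
      using eventually_nhds_in_open[of "{0<..}" s] that
      by (auto simp: eta_0[OF t] elim!: eventually_mono)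
    ultimately show ?thesis by (rule isCont_cong[THEN iffD1, rotated])
  qed
  have lim0: "filterlim (\<lambda>s. t / (2 * sqrt s)) at_top (at_right 0)"
    using t by real_asymp
  have liminf: "((\<lambda>s. t / (2 * sqrt s)) \<longlongrightarrow> 0) at_top"
    using t by real_asymp
  have "((\<lambda>s. - (2 / sqrt pi) * gauss (t / (2 * sqrt s))) \<longlongrightarrow> - (2 / sqrt pi) * (sqrt pi / 2)) (at_right 0)"
    by (intro tendsto_intros filterlim_compose[OF gauss_at_top] lim0)
  then have A: "((F \<circ> real_of_ereal) \<longlongrightarrow> -1) (at_right 0)"
    unfolding F_def[abs_def] zero_ereal_def ereal_tendsto_simps by simp
  have "((\<lambda>s. - (2 / sqrt pi) * gauss (t / (2 * sqrt s))) \<longlongrightarrow> - (2 / sqrt pi) * gauss 0) at_top"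
    by (intro tendsto_intros isCont_tendsto_compose[OF DERIV_isCont[OF gauss_deriv]] liminf)
  then have B: "((F \<circ> real_of_ereal) \<longlongrightarrow> 0) (at_left \<infinity>)"
    unfolding F_def[abs_def] ereal_tendsto_simps by (simp add: gauss_0)
  note FTC = interval_integral_FTC_nonneg[of 0 \<infinity> F "eta 0 t", OF _ _ _ _ A B]
  have si: "set_integrable lborel (einterval 0 \<infinity>) (eta 0 t)" and "(LBINT s=0..\<infinity>. eta 0 t s) = 1"
    using FTC D cont eta_0_nonneg[OF t] by auto
  moreover have ind: "indicator (einterval 0 \<infinity>) s *\<^sub>R eta 0 t s = eta 0 t s" for s
    by (cases "s > 0") (auto simp: einterval_iff indicator_def)
  ultimately have "integrable lborel (eta 0 t)" "(\<integral>s. eta 0 t s \<partial>lborel) = 1"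
    by (simp_all add: set_integrable_def interval_lebesgue_integral_def set_lebesgue_integral_def ind del: real_scaleR_def)
  then show ?thesis
    using eta_0_nonneg[OF t] by (simp add: nn_integral_eq_integral)
qed

text \<open>The Laplace transform of \<open>eta 0 t\<close> is exp (- t sqrt \<lambda>),
  multiplicative in t, which explains the identity. The proof needs no inversion of transforms: it
  integrates the convolution explicitly.\<close>

lemma nn_integral_eta_0_convolution:
  assumes t: "t > 0" and r: "r > 0"
  shows "(\<integral>\<^sup>+s. ennreal (eta 0 t s * eta 0 r (w - s)) \<partial>lborel) = ennreal (eta 0 (t + r) w)"
proof (cases "w > 0")
  case False
  then have "eta 0 t s * eta 0 r (w - s) = 0" for s by (cases "s > 0") auto
  then show ?thesis using False by (simp only:) simp
next
  case w: True
  txt \<open>The squares of \<open>zm\<close> and \<open>zp\<close> differ from the exponent of the integrand only by the constants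
    \<open>(t + r)\<^sup>2 / (4 w)\<close> and \<open>(t - r)\<^sup>2 / (4 w)\<close>, so a suitable combination of their Gauss integrals is an
    antiderivative.\<close>
  define D where "D s = sqrt (w * s * (w - s))" for s
  define zm where "zm s = (r * s - t * (w - s)) / (2 * D s)" for s
  define zp where "zp s = (r * s + t * (w - s)) / (2 * D s)" for s
  define E where "E s = exp (- (t\<^sup>2 / (4 * s)) - r\<^sup>2 / (4 * (w - s)))" for s
  define F where "F s = 1 / (2 * pi * (w * sqrt w)) *
    ((t + r) * exp (- ((t + r)\<^sup>2 / (4 * w))) * gauss (zm s) + (t - r) * exp (- ((t - r)\<^sup>2 / (4 * w))) * gauss (zp s))" for s
  have D_pos: "D s > 0" and D_sq: "(D s)\<^sup>2 = w * s * (w - s)" if "0 < s" "s < w" for s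
    using that by (auto simp: D_def)
  have D_deriv: "(D has_real_derivative w * (w - 2 * s) / (2 * D s)) (at s)" if "0 < s" "s < w" for s
  proof -
    have "((\<lambda>s. w * s * (w - s)) has_real_derivative w * (w - 2 * s)) (at s)"
      by (auto intro!: derivative_eq_intros simp: algebra_simps)
    then have "(D has_real_derivative inverse (sqrt (w * s * (w - s))) / 2 * (w * (w - 2 * s))) (at s)"
      unfolding D_def[abs_def] using that w by (intro DERIV_chain2[OF DERIV_real_sqrt]) auto
    then show ?thesis by (simp add: D_def divide_simps mult.commute)
  qed
  have zm_deriv: "(zm has_real_derivative w\<^sup>2 * (r * s + t * (w - s)) / (4 * D s ^ 3)) (at s)" if "0 < s" "s < w" for s
  proof -
    have "(zm has_real_derivative ((r + t) * (2 * D s) - (r * s - t * (w - s)) * (2 * (w * (w - 2 * s) / (2 * D s)))) / (2 * D s)\<^sup>2) (at s)"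
      unfolding zm_def[abs_def] using D_pos[OF that]
      by (auto intro!: derivative_eq_intros D_deriv[OF that] simp: power2_eq_square)
    also have "((r + t) * (2 * D s) - (r * s - t * (w - s)) * (2 * (w * (w - 2 * s) / (2 * D s)))) / (2 * D s)\<^sup>2
       = ((r + t) * 2 * (D s)\<^sup>2 - (r * s - t * (w - s)) * (w * (w - 2 * s))) / (4 * D s ^ 3)"
      using D_pos[OF that] by (simp add: field_simps power2_eq_square power3_eq_cube)
    also have "\<dots> = w\<^sup>2 * (r * s + t * (w - s)) / (4 * D s ^ 3)"
      unfolding D_sq[OF that] by (simp add: algebra_simps power2_eq_square)
    finally show ?thesis .
  qed
  have zp_deriv: "(zp has_real_derivative w\<^sup>2 * (r * s - t * (w - s)) / (4 * D s ^ 3)) (at s)" if "0 < s" "s < w" for s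
  proof -
    have "(zp has_real_derivative ((r - t) * (2 * D s) - (r * s + t * (w - s)) * (2 * (w * (w - 2 * s) / (2 * D s)))) / (2 * D s)\<^sup>2) (at s)"
      unfolding zp_def[abs_def] using D_pos[OF that]
      by (auto intro!: derivative_eq_intros D_deriv[OF that] simp: power2_eq_square)
    also have "((r - t) * (2 * D s) - (r * s + t * (w - s)) * (2 * (w * (w - 2 * s) / (2 * D s)))) / (2 * D s)\<^sup>2
       = ((r - t) * 2 * (D s)\<^sup>2 - (r * s + t * (w - s)) * (w * (w - 2 * s))) / (4 * D s ^ 3)"
      using D_pos[OF that] by (simp add: field_simps power2_eq_square power3_eq_cube)
    also have "\<dots> = w\<^sup>2 * (r * s - t * (w - s)) / (4 * D s ^ 3)"
      unfolding D_sq[OF that] by (simp add: algebra_simps power2_eq_square)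
    finally show ?thesis .
  qed
  have zm_E: "exp (- ((t + r)\<^sup>2 / (4 * w))) * exp (- (zm s)\<^sup>2) = E s" if "0 < s" "s < w" for s
  proof -
    have "(zm s)\<^sup>2 = (r * s - t * (w - s))\<^sup>2 / (4 * (w * s * (w - s)))"
      by (simp add: zm_def power_divide D_sq[OF that] power_mult_distrib)
    then have "- ((t + r)\<^sup>2 / (4 * w)) + (- (zm s)\<^sup>2) = - (t\<^sup>2 / (4 * s)) - r\<^sup>2 / (4 * (w - s))"
      using that w by (simp add: divide_simps) (simp add: algebra_simps power2_eq_square)
    then show ?thesis unfolding E_def exp_add[symmetric] by simp
  qed
  have zp_E: "exp (- ((t - r)\<^sup>2 / (4 * w))) * exp (- (zp s)\<^sup>2) = E s" if "0 < s" "s < w" for s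
  proof -
    have "(zp s)\<^sup>2 = (r * s + t * (w - s))\<^sup>2 / (4 * (w * s * (w - s)))"
      by (simp add: zp_def power_divide D_sq[OF that] power_mult_distrib)
    then have "- ((t - r)\<^sup>2 / (4 * w)) + (- (zp s)\<^sup>2) = - (t\<^sup>2 / (4 * s)) - r\<^sup>2 / (4 * (w - s))"
      using that w by (simp add: divide_simps) (simp add: algebra_simps power2_eq_square)
    then show ?thesis unfolding E_def exp_add[symmetric] by simp
  qed
  have integrand: "eta 0 t s * eta 0 r (w - s) = t * r / (4 * pi) * E s * (w * sqrt w)\<^sup>2 / (w * sqrt w * D s ^ 3)" if "0 < s" "s < w" for s
  proof -
    have "D s ^ 3 = (w * sqrt w) * (s * sqrt s) * ((w - s) * sqrt (w - s))"
    proof -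
      have "D s ^ 3 = (D s)\<^sup>2 * D s" by (simp add: power3_eq_cube power2_eq_square)
      also have "\<dots> = (w * sqrt w) * (s * sqrt s) * ((w - s) * sqrt (w - s))"
        unfolding D_sq[OF that] by (simp add: D_def real_sqrt_mult)
      finally show ?thesis .
    qed
    moreover have "eta 0 t s * eta 0 r (w - s) =
        t * r / (4 * (sqrt pi * sqrt pi)) * (exp (- (t\<^sup>2 / (4 * s))) * exp (- (r\<^sup>2 / (4 * (w - s))))) / ((s * sqrt s) * ((w - s) * sqrt (w - s)))"
      using that t r by (simp add: eta_0 mult_ac del: real_sqrt_mult_self)
    moreover have "exp (- (t\<^sup>2 / (4 * s))) * exp (- (r\<^sup>2 / (4 * (w - s)))) = E s"
      by (simp add: E_def flip: exp_add)
    ultimately show ?thesis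
      using that w by (simp add: power2_eq_square)
  qed
  have DF: "(F has_real_derivative eta 0 t s * eta 0 r (w - s)) (at s)" if "0 < s" "s < w" for s
  proof -
    let ?a = "exp (- ((t + r)\<^sup>2 / (4 * w)))" and ?b = "exp (- ((t - r)\<^sup>2 / (4 * w)))"
    have "(F has_real_derivative 1 / (2 * pi * (w * sqrt w)) *
        ((t + r) * ?a * (exp (- (zm s)\<^sup>2) * (w\<^sup>2 * (r * s + t * (w - s)) / (4 * D s ^ 3)))
        + (t - r) * ?b * (exp (- (zp s)\<^sup>2) * (w\<^sup>2 * (r * s - t * (w - s)) / (4 * D s ^ 3))))) (at s)"
      unfolding F_def[abs_def]
      by (intro DERIV_cmult DERIV_add DERIV_chain2[OF gauss_deriv] zm_deriv[OF that] zp_deriv[OF that])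
    also have "1 / (2 * pi * (w * sqrt w)) *
        ((t + r) * ?a * (exp (- (zm s)\<^sup>2) * (w\<^sup>2 * (r * s + t * (w - s)) / (4 * D s ^ 3)))
        + (t - r) * ?b * (exp (- (zp s)\<^sup>2) * (w\<^sup>2 * (r * s - t * (w - s)) / (4 * D s ^ 3))))
      = 1 / (2 * pi * (w * sqrt w)) *
        ((t + r) * (?a * exp (- (zm s)\<^sup>2)) * (w\<^sup>2 * (r * s + t * (w - s)) / (4 * D s ^ 3))
        + (t - r) * (?b * exp (- (zp s)\<^sup>2)) * (w\<^sup>2 * (r * s - t * (w - s)) / (4 * D s ^ 3)))"
      by (simp only: mult.assoc)
    also have "\<dots> = E s * w\<^sup>2 / (2 * pi * (w * sqrt w) * (4 * D s ^ 3)) *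
        ((t + r) * (r * s + t * (w - s)) + (t - r) * (r * s - t * (w - s)))"
      unfolding zm_E[OF that] zp_E[OF that] using D_pos[OF that] w by (simp add: field_simps)
    \<comment> \<open>The weights \<open>t + r\<close> and \<open>t - r\<close> in \<open>F\<close>
      were chosen for this cancellation: the combination no longer depends on
      \<open>s\<close>.\<close>
    also have "(t + r) * (r * s + t * (w - s)) + (t - r) * (r * s - t * (w - s)) = 2 * t * r * w"
      by (simp add: algebra_simps)
    also have "E s * w\<^sup>2 / (2 * pi * (w * sqrt w) * (4 * D s ^ 3)) * (2 * t * r * w) = eta 0 t s * eta 0 r (w - s)"
      unfolding integrand[OF that] using D_pos[OF that] w
      by (simp add: field_simps power2_eq_square)
    finally show ?thesis .
  qed
  have cont: "isCont (\<lambda>s. eta 0 t s * eta 0 r (w - s)) s" if "0 < s" "s < w" for s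
  proof -
    have "isCont (\<lambda>s. (t / (2 * sqrt pi) / (s * sqrt s) * exp (- (t\<^sup>2 / (4 * s)))) *
        (r / (2 * sqrt pi) / ((w - s) * sqrt (w - s)) * exp (- (r\<^sup>2 / (4 * (w - s)))))) s"
      using that by (auto intro!: continuous_intros)
    moreover have "\<forall>\<^sub>F s in nhds s. (t / (2 * sqrt pi) / (s * sqrt s) * exp (- (t\<^sup>2 / (4 * s)))) *
        (r / (2 * sqrt pi) / ((w - s) * sqrt (w - s)) * exp (- (r\<^sup>2 / (4 * (w - s))))) = eta 0 t s * eta 0 r (w - s)"
      using eventually_nhds_in_open[of "{0<..<w}" s] that
      by (auto simp: eta_0[OF t] eta_0[OF r] elim!: eventually_mono)
    ultimately show ?thesis by (rule isCont_cong[THEN iffD1, rotated])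
  qed
  \<comment> \<open>\<open>zm\<close> runs from minus to plus infinity, whereas \<open>zp\<close>
    tends to plus infinity at both ends. Hence the \<open>zp\<close> term has equal boundary values
    and only the \<open>zm\<close> term, with total increment \<open>sqrt pi\<close>,
    contributes.\<close>
  have zm_left: "filterlim zm at_bot (at_right 0)"
    unfolding zm_def D_def using t r w by real_asymp
  have zp_left: "filterlim zp at_top (at_right 0)"
    unfolding zp_def D_def using t r w by real_asymp
  have zm_right: "filterlim zm at_top (at_left w)"
    unfolding zm_def D_def using t r w by real_asymp
  have zp_right: "filterlim zp at_top (at_left w)"
    unfolding zp_def D_def using t r w by real_asymp
  have A: "((F \<circ> real_of_ereal) \<longlongrightarrow> 1 / (2 * pi * (w * sqrt w)) *
      ((t + r) * exp (- ((t + r)\<^sup>2 / (4 * w))) * (- sqrt pi / 2) + (t - r) * exp (- ((t - r)\<^sup>2 / (4 * w))) * (sqrt pi / 2))) (at_right (ereal 0))"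
    unfolding F_def[abs_def] ereal_tendsto_simps
    by (intro tendsto_intros filterlim_compose[OF gauss_at_top] filterlim_compose[OF gauss_at_bot] zm_left zp_left)
  have B: "((F \<circ> real_of_ereal) \<longlongrightarrow> 1 / (2 * pi * (w * sqrt w)) *
      ((t + r) * exp (- ((t + r)\<^sup>2 / (4 * w))) * (sqrt pi / 2) + (t - r) * exp (- ((t - r)\<^sup>2 / (4 * w))) * (sqrt pi / 2))) (at_left (ereal w))"
    unfolding F_def[abs_def] ereal_tendsto_simps
    by (intro tendsto_intros filterlim_compose[OF gauss_at_top] filterlim_compose[OF gauss_at_bot] zm_right zp_right)
  let ?f = "\<lambda>s. eta 0 t s * eta 0 r (w - s)"
  note FTC = interval_integral_FTC_nonneg[of "ereal 0" "ereal w" F ?f, OF _ _ _ _ A B]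
  have "set_integrable lborel (einterval (ereal 0) (ereal w)) ?f" and "(LBINT s=ereal 0..ereal w. ?f s) =
      1 / (2 * pi * (w * sqrt w)) * ((t + r) * exp (- ((t + r)\<^sup>2 / (4 * w))) * sqrt pi)"
    using FTC DF cont eta_0_nonneg[OF t] eta_0_nonneg[OF r] w by (auto simp: algebra_simps)
  moreover have "1 / (2 * pi * (w * sqrt w)) * ((t + r) * exp (- ((t + r)\<^sup>2 / (4 * w))) * sqrt pi) = eta 0 (t + r) w"
  proof -
    have "pi = sqrt pi * sqrt pi" by simp
    then show ?thesis using w t r by (simp add: eta_0 divide_simps)
  qed
  moreover have ind: "indicator (einterval (ereal 0) (ereal w)) s *\<^sub>R ?f s = ?f s" for s
    by (cases "s > 0"; cases "s < w") (auto simp: einterval_iff indicator_def)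
  ultimately have "integrable lborel ?f" "(\<integral>s. ?f s \<partial>lborel) = eta 0 (t + r) w"
    using w by (simp_all add: set_integrable_def interval_lebesgue_integral_def set_lebesgue_integral_def ind del: real_scaleR_def)
  then show ?thesis
    using eta_0_nonneg[OF t] eta_0_nonneg[OF r] by (simp add: nn_integral_eq_integral)
qed

section \<open>Integrals against the subordination kernel\<close>

text \<open>One fixed choice per order \<open>k\<close>, independent of time; the comparison
  constants of the theorem are later assembled from these numbers, hence do not depend on
  \<open>f\<close>.\<close>

definition eta_const :: "nat \<Rightarrow> real" where
  "eta_const k = (SOME C. C > 0 \<and> (\<forall>t>0. \<forall>s. \<bar>eta k t s\<bar> \<le> C * t powr (- real k) * eta 0 (t / sqrt 2) s))"

lemma eta_const_pos: "eta_const k > 0"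
  and eta_bound: "t > 0 \<Longrightarrow> \<bar>eta k t s\<bar> \<le> eta_const k * t powr (- real k) * eta 0 (t / sqrt 2) s"
  using someI_ex[OF eta_bound_exists[of k]] unfolding eta_const_def[symmetric] by blast+

lemma integrable_eta_0: "t > 0 \<Longrightarrow> integrable lborel (eta 0 t)"
  and integral_eta_0: "t > 0 \<Longrightarrow> (\<integral>s. eta 0 t s \<partial>lborel) = 1"
proof -
  assume t: "t > 0"
  show "integrable lborel (eta 0 t)"
    using nn_integral_eta_0[OF t] eta_0_nonneg[OF t] by (intro integrableI_nonneg) auto
  show "(\<integral>s. eta 0 t s \<partial>lborel) = 1"
    using nn_integral_eta_0[OF t] eta_0_nonneg[OF t] by (subst integral_eq_nn_integral) auto
qed

text \<open>\<open>V\<close> stands for the heat orbit of a function at a fixed point. It is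
  controlled at positive times only, which suffices because \<open>eta\<close> vanishes
  elsewhere.\<close>

lemma integrable_eta_scaleR:
  fixes V :: "real \<Rightarrow> complex"
  assumes t: "t > 0" and V: "V \<in> borel_measurable borel" "\<And>s. s > 0 \<Longrightarrow> norm (V s) \<le> B"
  shows "integrable lborel (\<lambda>s. eta k t s *\<^sub>R V s)"
    and "norm (\<integral>s. eta k t s *\<^sub>R V s \<partial>lborel) \<le> eta_const k * t powr (- real k) * B"
proof -
  have t': "t / sqrt 2 > 0" using t by simp
  have bd: "norm (eta k t s *\<^sub>R V s) \<le> eta_const k * t powr (- real k) * B * eta 0 (t / sqrt 2) s" for s
  proof (cases "s > 0")
    case True
    have "norm (eta k t s *\<^sub>R V s) \<le> (eta_const k * t powr (- real k) * eta 0 (t / sqrt 2) s) * B"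
      unfolding norm_scaleR real_norm_def
      using eta_bound[OF t] V(2)[OF True] by (intro mult_mono') auto
    then show ?thesis by (simp add: mult_ac)
  qed simp
  have int: "integrable lborel (\<lambda>s. eta_const k * t powr (- real k) * B * eta 0 (t / sqrt 2) s)"
    using integrable_eta_0[OF t'] by simp
  show i: "integrable lborel (\<lambda>s. eta k t s *\<^sub>R V s)"
  proof (rule Bochner_Integration.integrable_bound[OF int])
    show "(\<lambda>s. eta k t s *\<^sub>R V s) \<in> borel_measurable lborel" using V(1) by simp
    show "AE s in lborel. norm (eta k t s *\<^sub>R V s) \<le> norm (eta_const k * t powr (- real k) * B * eta 0 (t / sqrt 2) s)"
      using bd by (intro AE_I2) (metis abs_ge_self order_trans real_norm_def)
  qed
  have "norm (\<integral>s. eta k t s *\<^sub>R V s \<partial>lborel) \<le> (\<integral>s. eta_const k * t powr (- real k) * B * eta 0 (t / sqrt 2) s \<partial>lborel)"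
    by (intro order_trans[OF integral_norm_bound] integral_mono integrable_norm i int bd)
  then show "norm (\<integral>s. eta k t s *\<^sub>R V s \<partial>lborel) \<le> eta_const k * t powr (- real k) * B"
    by (simp add: integral_eta_0[OF t'])
qed

lemma has_vector_derivative_eta_integral:
  fixes V :: "real \<Rightarrow> complex"
  assumes t: "t > 0" and V: "V \<in> borel_measurable borel" "\<And>s. s > 0 \<Longrightarrow> norm (V s) \<le> B"
  shows "((\<lambda>t. \<integral>s. eta k t s *\<^sub>R V s \<partial>lborel) has_vector_derivative
     (\<integral>s. eta (Suc k) t s *\<^sub>R V s \<partial>lborel)) (at t)"
proof (rule has_vector_derivative_lebesgue_integral[where T="{t / 2<..<2 * t}"])
  \<comment> \<open>The bound for order \<open>Suc k\<close> at time \<open>r\<close> involves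
    \<open>eta 0 (r / sqrt 2)\<close>. Over the window, \<open>t1\<close> is the infimum of
    \<open>r / sqrt 2\<close>: there the exponential factor is largest, and the linear prefactor
    exceeds \<open>t1\<close> by at most the factor 4.\<close>
  define t1 where "t1 = t / 2 / sqrt 2"
  have t1: "t1 > 0" using t by (simp add: t1_def)
  have B: "B \<ge> 0" using V(2)[of 1] norm_ge_zero[of "V 1"] by linarith
  define g where "g s = eta_const (Suc k) * (t / 2) powr (- real (Suc k)) * (4 * eta 0 t1 s) * B" for s
  show "integrable lborel g"
    unfolding g_def[abs_def] using integrable_eta_0[OF t1] by simp
  show "norm (eta (Suc k) r s *\<^sub>R V s) \<le> g s" if r: "r \<in> {t / 2<..<2 * t}" for r s
  proof (cases "s > 0")
    case s: True
    have r0: "r > 0" using r t by auto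
    have "eta 0 (r / sqrt 2) s \<le> 4 * eta 0 t1 s"
    proof -
      have exp_le: "exp (- ((r / sqrt 2)\<^sup>2 / (4 * s))) \<le> exp (- (t1\<^sup>2 / (4 * s)))"
      proof -
        have "t1\<^sup>2 \<le> (r / sqrt 2)\<^sup>2"
          using r t unfolding t1_def by (intro power_mono divide_right_mono) auto
        then show ?thesis using s by (auto intro!: divide_right_mono)
      qed
      define X where "X = 1 / (2 * sqrt pi) / (s * sqrt s)"
      have "X \<ge> 0" using s by (simp add: X_def)
      moreover have "r / sqrt 2 \<le> 4 * t1" using r by (simp add: t1_def divide_simps)
      ultimately have "r / sqrt 2 * X * exp (- ((r / sqrt 2)\<^sup>2 / (4 * s))) \<le> 4 * t1 * X * exp (- (t1\<^sup>2 / (4 * s)))"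
        using exp_le t1 by (intro mult_mono) auto
      moreover have "eta 0 (r / sqrt 2) s = r / sqrt 2 * X * exp (- ((r / sqrt 2)\<^sup>2 / (4 * s)))"
        using r0 by (subst eta_0[OF _ s]) (simp_all add: X_def del: power_divide)
      moreover have "eta 0 t1 s = t1 * X * exp (- (t1\<^sup>2 / (4 * s)))"
        by (subst eta_0[OF t1 s]) (simp add: X_def)
      ultimately show ?thesis by simp
    qed
    moreover have "r powr (- real (Suc k)) \<le> (t / 2) powr (- real (Suc k))"
      using r t by (intro powr_mono2') auto
    ultimately have "eta_const (Suc k) * r powr (- real (Suc k)) * eta 0 (r / sqrt 2) s \<le>
        eta_const (Suc k) * (t / 2) powr (- real (Suc k)) * (4 * eta 0 t1 s)"
      using eta_const_pos[of "Suc k"] eta_0_nonneg[of "r / sqrt 2" s] r0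
      by (intro mult_mono) (auto intro: less_imp_le)
    then have "\<bar>eta (Suc k) r s\<bar> \<le> eta_const (Suc k) * (t / 2) powr (- real (Suc k)) * (4 * eta 0 t1 s)"
      using eta_bound[OF r0, of "Suc k" s] by linarith
    then show ?thesis
      unfolding norm_scaleR real_norm_def g_def using V(2)[OF s] by (intro mult_mono') auto
  qed (simp add: g_def)
  show "integrable lborel (\<lambda>s. eta k r s *\<^sub>R V s)" if "r \<in> {t / 2<..<2 * t}" for r
    using that t by (intro integrable_eta_scaleR(1)[OF _ V]) auto
  show "((\<lambda>t. eta k t s *\<^sub>R V s) has_vector_derivative eta (Suc k) r s *\<^sub>R V s) (at r)"
    if "r \<in> {t / 2<..<2 * t}" for r s
  proof -
    have "r > 0" using that t by auto
    from has_vector_derivative_scaleR[OF eta_deriv[OF this, of k s] has_vector_derivative_const[of "V s"]]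
    show ?thesis by simp
  qed
  show "(\<lambda>s. eta (Suc k) t s *\<^sub>R V s) \<in> borel_measurable lborel" using V(1) by simp
qed (use t in auto)

text \<open>After the shift \<open>w = s + u\<close>, Fubini puts the convolution of the two
  densities inside. \<open>B\<close> times their product is an integrable majorant because both have
  mass one.\<close>

lemma eta_0_convolution_integral:
  fixes V :: "real \<Rightarrow> complex"
  assumes t: "t > 0" and r: "r > 0"
    and V: "V \<in> borel_measurable borel" "\<And>s. s > 0 \<Longrightarrow> norm (V s) \<le> B"
  shows "(\<integral>s. eta 0 t s *\<^sub>R (\<integral>u. eta 0 r u *\<^sub>R V (s + u) \<partial>lborel) \<partial>lborel) =
    (\<integral>w. eta 0 (t + r) w *\<^sub>R V w \<partial>lborel)"
proof -
  note [measurable] = V(1)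
  have m[measurable]: "(\<lambda>p. eta k t (a p)) \<in> borel_measurable N" if "a \<in> borel_measurable N" for a N k t
    using that by measurable
  have B: "B \<ge> 0" using V(2)[of 1] norm_ge_zero[of "V 1"] by linarith
  define F where "F s w = (eta 0 t s * eta 0 r (w - s)) *\<^sub>R V w" for s w
  have F_bound: "norm (F s w) \<le> eta 0 t s * eta 0 r (w - s) * B" for s w
  proof (cases "s > 0 \<and> w > s")
    case True
    then show ?thesis using V(2)[of w] eta_0_nonneg[OF t, of s] eta_0_nonneg[OF r, of "w - s"]
      by (auto simp: F_def intro!: mult_left_mono)
  qed (auto simp: F_def)
  have shift: "integrable lborel (\<lambda>w. eta 0 r (w - s))" "(\<integral>w. eta 0 r (w - s) \<partial>lborel) = 1" for s
    using lborel_integrable_real_affine[OF integrable_eta_0[OF r], of 1 "- s"]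
      lborel_integral_real_affine[of 1 "eta 0 r" "- s"] integral_eta_0[OF r] by simp_all
  have F_int: "integrable lborel (F s)" for s
  proof (rule Bochner_Integration.integrable_bound)
    show "integrable lborel (\<lambda>w. eta 0 t s * eta 0 r (w - s) * B)"
      using shift(1) by simp
    show "F s \<in> borel_measurable lborel" unfolding F_def[abs_def] by measurable
    show "AE w in lborel. norm (F s w) \<le> norm (eta 0 t s * eta 0 r (w - s) * B)"
      using order_trans[OF F_bound abs_ge_self] by simp
  qed
  have F_meas: "case_prod F \<in> borel_measurable (lborel \<Otimes>\<^sub>M lborel)"
    unfolding F_def by measurable
  have int2: "integrable (lborel \<Otimes>\<^sub>M lborel) (case_prod F)"
  proof (rule lborel_pair.Fubini_integrable[OF F_meas])
    show "AE s in lborel. integrable lborel (\<lambda>w. case (s, w) of (s, w) \<Rightarrow> F s w)"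
      using F_int by simp
    show "integrable lborel (\<lambda>s. \<integral>w. norm (case (s, w) of (s, w) \<Rightarrow> F s w) \<partial>lborel)"
    proof (rule Bochner_Integration.integrable_bound[where f="\<lambda>s. eta 0 t s * B"])
      show "integrable lborel (\<lambda>s. eta 0 t s * B)" using integrable_eta_0[OF t] by simp
      show "(\<lambda>s. \<integral>w. norm (case (s, w) of (s, w) \<Rightarrow> F s w) \<partial>lborel) \<in> borel_measurable lborel"
        using F_meas by measurable
      have "(\<integral>w. norm (F s w) \<partial>lborel) \<le> (\<integral>w. eta 0 t s * eta 0 r (w - s) * B \<partial>lborel)" for s
        using F_int shift(1) F_bound by (intro integral_mono) auto
      then show "AE s in lborel. norm (\<integral>w. norm (case (s, w) of (s, w) \<Rightarrow> F s w) \<partial>lborel) \<le> norm (eta 0 t s * B)"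
        using B eta_0_nonneg[OF t] by (intro AE_I2) (simp add: shift(2))
    qed
  qed
  have "(\<integral>s. eta 0 t s *\<^sub>R (\<integral>u. eta 0 r u *\<^sub>R V (s + u) \<partial>lborel) \<partial>lborel) = (\<integral>s. \<integral>w. F s w \<partial>lborel \<partial>lborel)"
  proof (rule Bochner_Integration.integral_cong[OF refl])
    fix s
    have "(\<integral>u. eta 0 r u *\<^sub>R V (s + u) \<partial>lborel) = (\<integral>w. eta 0 r (w - s) *\<^sub>R V w \<partial>lborel)"
      by (subst lborel_integral_real_affine[of 1 _ "- s"]) simp_all
    then show "eta 0 t s *\<^sub>R (\<integral>u. eta 0 r u *\<^sub>R V (s + u) \<partial>lborel) = (\<integral>w. F s w \<partial>lborel)"
      by (simp add: F_def flip: scaleR_scaleR)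
  qed
  also have "\<dots> = (\<integral>w. \<integral>s. F s w \<partial>lborel \<partial>lborel)"
    by (rule lborel_pair.Fubini_integral[OF int2, symmetric])
  also have "\<dots> = (\<integral>w. eta 0 (t + r) w *\<^sub>R V w \<partial>lborel)"
  proof (rule Bochner_Integration.integral_cong[OF refl])
    fix w
    have nn: "0 \<le> eta 0 t s * eta 0 r (w - s)" for s
      using eta_0_nonneg[OF t] eta_0_nonneg[OF r] by simp
    have tr: "0 \<le> eta 0 (t + r) w" using t r by (intro eta_0_nonneg) simp
    have "integrable lborel (\<lambda>s. eta 0 t s * eta 0 r (w - s))"
      using nn nn_integral_eta_0_convolution[OF t r, of w] by (intro integrableI_nonneg) auto
    moreover have "(\<integral>s. eta 0 t s * eta 0 r (w - s) \<partial>lborel) = eta 0 (t + r) w"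
      using nn nn_integral_eta_0_convolution[OF t r, of w] tr by (subst integral_eq_nn_integral) auto
    ultimately show "(\<integral>s. F s w \<partial>lborel) = eta 0 (t + r) w *\<^sub>R V w"
      unfolding F_def by simp
  qed
  finally show ?thesis .
qed

section \<open>Markovian kernels and subordinated semigroups\<close>

lemma integrable_pair_bounded:
  fixes F :: "'a \<Rightarrow> 'b \<Rightarrow> 'c::{banach, second_countable_topology}"
  assumes "pair_sigma_finite M N" and g: "integrable M g" and h: "integrable N h"
    and F: "case_prod F \<in> borel_measurable (M \<Otimes>\<^sub>M N)"
    and bound: "\<And>x. x \<in> space M \<Longrightarrow> AE y in N. norm (F x y) \<le> g x * h y"
  shows "integrable (M \<Otimes>\<^sub>M N) (case_prod F)"
proof -
  interpret pair_sigma_finite M N by fact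
  have int: "integrable N (F x)" if x: "x \<in> space M" for x
  proof (rule Bochner_Integration.integrable_bound)
    show "integrable N (\<lambda>y. g x * h y)" using h by simp
    show "F x \<in> borel_measurable N"
      using measurable_compose_Pair1[OF x F] by simp
    show "AE y in N. norm (F x y) \<le> norm (g x * h y)"
      using bound[OF x] by eventually_elim simp
  qed
  show ?thesis
  proof (rule Fubini_integrable[OF F])
    show "AE x in M. integrable N (\<lambda>y. case (x, y) of (x, y) \<Rightarrow> F x y)"
      using int by (intro AE_I2) simp
    show "integrable M (\<lambda>x. \<integral>y. norm (case (x, y) of (x, y) \<Rightarrow> F x y) \<partial>N)"
    proof (rule Bochner_Integration.integrable_bound)
      show "integrable M (\<lambda>x. g x * (\<integral>y. h y \<partial>N))" using g by simp
      show "(\<lambda>x. \<integral>y. norm (case (x, y) of (x, y) \<Rightarrow> F x y) \<partial>N) \<in> borel_measurable M"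
        using F by measurable
      show "AE x in M. norm (\<integral>y. norm (case (x, y) of (x, y) \<Rightarrow> F x y) \<partial>N) \<le> norm (g x * (\<integral>y. h y \<partial>N))"
      proof (rule AE_I2)
        fix x assume x: "x \<in> space M"
        have "(\<integral>y. norm (F x y) \<partial>N) \<le> (\<integral>y. g x * h y \<partial>N)"
          using int[OF x] h bound[OF x] by (intro integral_mono_AE) auto
        then show "norm (\<integral>y. norm (case (x, y) of (x, y) \<Rightarrow> F x y) \<partial>N) \<le> norm (g x * (\<integral>y. h y \<partial>N))"
          by simp
      qed
    qed
  qed
qed

text \<open>The interface between subordination and the Laguerre operator. The laws hold at every
  point, not merely almost everywhere, and are stated with nonnegative integrals, so that they also
  provide integrability.\<close>

locale markov_kernel = sigma_finite_measure M for M :: "'a measure" +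
  fixes K :: "real \<Rightarrow> 'a \<Rightarrow> 'a \<Rightarrow> real"
  assumes kernel_measurable: "(\<lambda>(s, x, y). K s x y) \<in> borel_measurable (borel \<Otimes>\<^sub>M M \<Otimes>\<^sub>M M)"
    and kernel_nonneg: "\<And>s x y. s > 0 \<Longrightarrow> x \<in> space M \<Longrightarrow> y \<in> space M \<Longrightarrow> 0 \<le> K s x y"
    and kernel_mass: "\<And>s x. s > 0 \<Longrightarrow> x \<in> space M \<Longrightarrow> (\<integral>\<^sup>+y. ennreal (K s x y) \<partial>M) = 1"
    and kernel_semigroup: "\<And>s r x z. s > 0 \<Longrightarrow> r > 0 \<Longrightarrow> x \<in> space M \<Longrightarrow> z \<in> space M \<Longrightarrow>
      (\<integral>\<^sup>+y. ennreal (K s x y * K r y z) \<partial>M) = ennreal (K (s + r) x z)"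
begin

definition heat :: "real \<Rightarrow> ('a \<Rightarrow> complex) \<Rightarrow> 'a \<Rightarrow> complex" where
  "heat s f x = (\<integral>y. K s x y *\<^sub>R f y \<partial>M)"

text \<open>For \<open>k > 0\<close> this is the candidate for the k-th time derivative of the
  subordinated semigroup, obtained by letting all derivatives fall on the density.\<close>

definition poisson :: "nat \<Rightarrow> real \<Rightarrow> ('a \<Rightarrow> complex) \<Rightarrow> 'a \<Rightarrow> complex" where
  "poisson k t f x = (\<integral>s. eta k t s *\<^sub>R heat s f x \<partial>lborel)"

definition bounded_by :: "real \<Rightarrow> ('a \<Rightarrow> complex) \<Rightarrow> bool" where
  "bounded_by B f \<longleftrightarrow> f \<in> borel_measurable M \<and> (AE x in M. norm (f x) \<le> B)"

text \<open>Monotonicity steps need a nonnegative bound; over a null measure \<open>B\<close> itself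
  could be negative.\<close>

lemma bounded_by_abs: "bounded_by B f \<Longrightarrow> bounded_by \<bar>B\<bar> f"
  unfolding bounded_by_def by (auto elim!: eventually_mono)

lemma measurable_kernel [measurable (raw)]:
  assumes "a \<in> borel_measurable N" "b \<in> N \<rightarrow>\<^sub>M M" "c \<in> N \<rightarrow>\<^sub>M M"
  shows "(\<lambda>p. K (a p) (b p) (c p)) \<in> borel_measurable N"
  using measurable_compose[OF measurable_Pair[OF assms(1) measurable_Pair[OF assms(2,3)]] kernel_measurable]
  by simp

lemma measurable_heat [measurable (raw)]:
  assumes [measurable]: "a \<in> borel_measurable N" "b \<in> N \<rightarrow>\<^sub>M M" "f \<in> borel_measurable M"
  shows "(\<lambda>p. heat (a p) f (b p)) \<in> borel_measurable N"
  unfolding heat_def by measurable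

lemma measurable_poisson [measurable (raw)]:
  assumes [measurable]: "b \<in> N \<rightarrow>\<^sub>M M" "f \<in> borel_measurable M"
  shows "(\<lambda>p. poisson k t f (b p)) \<in> borel_measurable N"
  unfolding poisson_def by measurable

lemma integrable_kernel: "s > 0 \<Longrightarrow> x \<in> space M \<Longrightarrow> integrable M (K s x)"
  and integral_kernel: "s > 0 \<Longrightarrow> x \<in> space M \<Longrightarrow> (\<integral>y. K s x y \<partial>M) = 1"
proof -
  assume s: "s > 0" and x: "x \<in> space M"
  have [measurable]: "K s x \<in> borel_measurable M" using x by measurable
  show "integrable M (K s x)"
    using kernel_mass[OF s x] kernel_nonneg[OF s x] by (intro integrableI_nonneg) auto
  show "(\<integral>y. K s x y \<partial>M) = 1"
    using kernel_mass[OF s x] kernel_nonneg[OF s x] by (subst integral_eq_nn_integral) auto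
qed

text \<open>The null set on which \<open>f\<close> may exceed \<open>B\<close> is integrated out, so
  an almost everywhere bound on \<open>f\<close> becomes a bound on \<open>heat s f\<close> at every
  point.\<close>

lemma integrable_kernel_scaleR:
  assumes s: "s > 0" and x: "x \<in> space M" and f: "bounded_by B f"
  shows "integrable M (\<lambda>y. K s x y *\<^sub>R f y)"
    and "norm (heat s f x) \<le> B"
proof -
  have [measurable]: "f \<in> borel_measurable M" "K s x \<in> borel_measurable M"
    using f x by (simp_all add: bounded_by_def)
  have le: "AE y in M. norm (K s x y *\<^sub>R f y) \<le> K s x y * B"
    using f[unfolded bounded_by_def, THEN conjunct2] AE_space
    by eventually_elim (auto intro!: mult_left_mono simp: kernel_nonneg[OF s x])
  have int: "integrable M (\<lambda>y. K s x y * B)" using integrable_kernel[OF s x] by simp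
  show i: "integrable M (\<lambda>y. K s x y *\<^sub>R f y)"
    by (rule Bochner_Integration.integrable_bound[OF int]) (use le in \<open>auto elim!: eventually_mono\<close>)
  have "norm (heat s f x) \<le> (\<integral>y. K s x y * B \<partial>M)"
    unfolding heat_def
    by (intro order_trans[OF integral_norm_bound] integral_mono_AE integrable_norm i int le)
  then show "norm (heat s f x) \<le> B"
    by (simp add: integral_kernel[OF s x])
qed

text \<open>Chapman-Kolmogorov and Fubini. Integrability is checked with the intermediate point
  \<open>y\<close> innermost, because that integral is known exactly: it leaves the kernel at time
  \<open>s + r\<close> against the modulus of \<open>f\<close>.\<close>

lemma heat_add:
  assumes s: "s > 0" and r: "r > 0" and x: "x \<in> space M" and f: "bounded_by B f"
  shows "heat s (heat r f) x = heat (s + r) f x"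
proof -
  have f_meas [measurable]: "f \<in> borel_measurable M" and f_le: "AE y in M. norm (f y) \<le> B"
    using f by (simp_all add: bounded_by_def)
  interpret P: pair_sigma_finite M M ..
  define F where "F z y = (K s x y * K r y z) *\<^sub>R f z" for z y
  have conv: "integrable M (\<lambda>y. K s x y * K r y z)" "(\<integral>y. K s x y * K r y z \<partial>M) = K (s + r) x z"
    if z: "z \<in> space M" for z
  proof -
    have [measurable]: "(\<lambda>y. K s x y * K r y z) \<in> borel_measurable M" using x z by measurable
    have nn: "AE y in M. 0 \<le> K s x y * K r y z"
      using kernel_nonneg s r x z by (intro AE_I2) simp
    show "integrable M (\<lambda>y. K s x y * K r y z)"
      using kernel_semigroup[OF s r x z] nn by (intro integrableI_nonneg) auto
    have "0 \<le> K (s + r) x z" using kernel_nonneg[of "s + r"] s r x z by simp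
    then show "(\<integral>y. K s x y * K r y z \<partial>M) = K (s + r) x z"
      using kernel_semigroup[OF s r x z] nn by (subst integral_eq_nn_integral) auto
  qed
  have F_meas: "case_prod F \<in> borel_measurable (M \<Otimes>\<^sub>M M)"
    unfolding F_def using x by measurable
  have "integrable (M \<Otimes>\<^sub>M M) (case_prod F)"
  proof (rule P.Fubini_integrable[OF F_meas])
    show "AE z in M. integrable M (\<lambda>y. case (z, y) of (z, y) \<Rightarrow> F z y)"
      unfolding F_def using conv(1) by (intro AE_I2) simp
    have eq: "(\<integral>y. norm (F z y) \<partial>M) = norm (K (s + r) x z *\<^sub>R f z)" if z: "z \<in> space M" for z
    proof -
      have "(\<integral>y. norm (F z y) \<partial>M) = (\<integral>y. (K s x y * K r y z) * norm (f z) \<partial>M)"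
        using kernel_nonneg s r x z by (intro Bochner_Integration.integral_cong) (auto simp: F_def)
      also have "\<dots> = K (s + r) x z * norm (f z)" using conv[OF z] by simp
      finally show ?thesis using kernel_nonneg[of "s + r" x z] s r x z by simp
    qed
    show "integrable M (\<lambda>z. \<integral>y. norm (case (z, y) of (z, y) \<Rightarrow> F z y) \<partial>M)"
      using integrable_norm[OF integrable_kernel_scaleR(1)[OF _ x f, of "s + r"]] s r
      by (subst Bochner_Integration.integrable_cong[OF refl, of _ _ "\<lambda>z. norm (K (s + r) x z *\<^sub>R f z)"]) (simp_all add: eq)
  qed
  then have "(\<integral>y. \<integral>z. F z y \<partial>M \<partial>M) = (\<integral>z. \<integral>y. F z y \<partial>M \<partial>M)"
    by (rule P.Fubini_integral)
  moreover have "(\<integral>z. F z y \<partial>M) = K s x y *\<^sub>R heat r f y" for y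
    by (simp add: F_def heat_def flip: scaleR_scaleR)
  moreover have "(\<integral>y. F z y \<partial>M) = K (s + r) x z *\<^sub>R f z" if "z \<in> space M" for z
    using conv[OF that] by (simp add: F_def)
  ultimately show ?thesis
    by (simp add: heat_def cong: Bochner_Integration.integral_cong)
qed

lemma bounded_heat:
  assumes "bounded_by B f" "x \<in> space M"
  shows "(\<lambda>s. heat s f x) \<in> borel_measurable borel"
    and "\<And>s. s > 0 \<Longrightarrow> norm (heat s f x) \<le> B"
proof -
  have [measurable]: "f \<in> borel_measurable M" using assms by (simp add: bounded_by_def)
  show "(\<lambda>s. heat s f x) \<in> borel_measurable borel" using assms(2) by measurable
qed (use integrable_kernel_scaleR(2) assms in blast)

lemma norm_poisson_le:
  assumes "t > 0" "bounded_by B f" "x \<in> space M"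
  shows "norm (poisson k t f x) \<le> eta_const k * t powr (- real k) * B"
  unfolding poisson_def by (rule integrable_eta_scaleR(2)[OF assms(1) bounded_heat[OF assms(2,3)]])

lemma bounded_poisson:
  assumes "t > 0" "bounded_by B f"
  shows "bounded_by (eta_const k * t powr (- real k) * B) (poisson k t f)"
  using norm_poisson_le[OF assms] measurable_poisson[of "\<lambda>x. x" M f k t] assms(2)
  by (auto simp: bounded_by_def)

section \<open>Time derivatives and the semigroup law of the subordinated semigroup\<close>

lemma poisson_has_vector_derivative:
  assumes "t > 0" "bounded_by B f" "x \<in> space M"
  shows "((\<lambda>t. poisson k t f x) has_vector_derivative poisson (Suc k) t f x) (at t)"
  unfolding poisson_def by (rule has_vector_derivative_eta_integral[OF assms(1) bounded_heat[OF assms(2,3)]])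

lemma poisson_shift_has_vector_derivative:
  assumes "c + t > 0" "bounded_by B f" "x \<in> space M"
  shows "((\<lambda>t. poisson k (c + t) f x) has_vector_derivative poisson (Suc k) (c + t) f x) (at t)"
proof -
  have "((\<lambda>t. c + t) has_vector_derivative 1) (at t)"
    by (auto intro!: derivative_eq_intros)
  from vector_diff_chain_at[OF this poisson_has_vector_derivative[OF assms, of k]]
  show ?thesis by (simp add: o_def)
qed

text \<open>The heat operator commutes with the subordination integral by Fubini, with a product
  majorant, and \<open>heat_add\<close> merges the two heat times. This reduces the law for
  \<open>poisson\<close> to a convolution of densities.\<close>

lemma heat_poisson:
  assumes s: "s > 0" and r: "r > 0" and x: "x \<in> space M" and f: "bounded_by B f"
  shows "heat s (poisson 0 r f) x = (\<integral>u. eta 0 r u *\<^sub>R heat (s + u) f x \<partial>lborel)"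
proof -
  have [measurable]: "f \<in> borel_measurable M" using f by (simp add: bounded_by_def)
  interpret P: pair_sigma_finite lborel M ..
  define F where "F u y = (K s x y * eta 0 r u) *\<^sub>R heat u f y" for u y
  have bound: "norm (F u y) \<le> eta 0 r u * (K s x y * B)" if "y \<in> space M" for u y
  proof (cases "u > 0")
    case True
    have "norm (F u y) = (K s x y * eta 0 r u) * norm (heat u f y)"
      using kernel_nonneg[OF s x that] eta_0_nonneg[OF r, of u] by (simp add: F_def)
    also have "\<dots> \<le> (K s x y * eta 0 r u) * B"
      using kernel_nonneg[OF s x that] eta_0_nonneg[OF r, of u] integrable_kernel_scaleR(2)[OF True that f]
      by (intro mult_left_mono) auto
    finally show ?thesis by (simp add: mult_ac)
  qed (simp add: F_def)
  have "integrable (lborel \<Otimes>\<^sub>M M) (case_prod F)"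
  proof (rule integrable_pair_bounded)
    show "pair_sigma_finite lborel M" ..
    show "integrable lborel (eta 0 r)" by (rule integrable_eta_0[OF r])
    show "integrable M (\<lambda>y. K s x y * B)" using integrable_kernel[OF s x] by simp
    show "case_prod F \<in> borel_measurable (lborel \<Otimes>\<^sub>M M)" unfolding F_def using x by measurable
    show "AE y in M. norm (F u y) \<le> eta 0 r u * (K s x y * B)" for u
      using bound by (intro AE_I2) auto
  qed
  then have "(\<integral>y. \<integral>u. F u y \<partial>lborel \<partial>M) = (\<integral>u. \<integral>y. F u y \<partial>M \<partial>lborel)"
    by (rule P.Fubini_integral)
  moreover have "(\<integral>u. F u y \<partial>lborel) = K s x y *\<^sub>R poisson 0 r f y" for y
    by (simp add: F_def poisson_def flip: scaleR_scaleR)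
  moreover have "(\<integral>y. F u y \<partial>M) = eta 0 r u *\<^sub>R heat (s + u) f x" for u
  proof (cases "u > 0")
    case True
    have "(\<integral>y. F u y \<partial>M) = eta 0 r u *\<^sub>R heat s (heat u f) x"
      unfolding F_def mult.commute[of _ "eta 0 r u"] by (simp add: heat_def[of s] flip: scaleR_scaleR)
    then show ?thesis using heat_add[OF s True x f] by simp
  qed (simp add: F_def)
  ultimately show ?thesis by (simp add: heat_def[of s])
qed

lemma poisson_add_0:
  assumes t: "t > 0" and r: "r > 0" and x: "x \<in> space M" and f: "bounded_by B f"
  shows "poisson 0 (t + r) f x = poisson 0 t (poisson 0 r f) x"
proof -
  have "eta 0 t s *\<^sub>R heat s (poisson 0 r f) x =
      eta 0 t s *\<^sub>R (\<integral>u. eta 0 r u *\<^sub>R heat (s + u) f x \<partial>lborel)" for s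
    using heat_poisson[OF _ r x f] by (cases "s > 0") auto
  note * = this
  show ?thesis
    unfolding poisson_def[of _ _ _ x] *
    by (rule eta_0_convolution_integral[OF t r bounded_heat[OF f x], symmetric])
qed

text \<open>The derivative falls on the inner parameter. On \<open>{r / 2<..}\<close> the estimate
  for order \<open>Suc k\<close> is decreasing in time, so its value at \<open>r / 2\<close> times
  the kernel is an integrable majorant.\<close>

lemma heat_poisson_has_vector_derivative:
  assumes s: "s > 0" and r: "r > 0" and x: "x \<in> space M" and f: "bounded_by B f"
  shows "((\<lambda>r. heat s (poisson k r f) x) has_vector_derivative heat s (poisson (Suc k) r f) x) (at r)"
  unfolding heat_def[of s]
proof (rule has_vector_derivative_lebesgue_integral[where T="{r / 2<..}"])
  have [measurable]: "f \<in> borel_measurable M" using f by (simp add: bounded_by_def)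
  show "integrable M (\<lambda>y. K s x y *\<^sub>R poisson k q f y)" if "q \<in> {r / 2<..}" for q
    using that r by (intro integrable_kernel_scaleR(1)[OF s x bounded_poisson[OF _ f]]) auto
  show "((\<lambda>q. K s x y *\<^sub>R poisson k q f y) has_vector_derivative K s x y *\<^sub>R poisson (Suc k) q f y) (at q)"
    if "q \<in> {r / 2<..}" "y \<in> space M" for q y
  proof -
    have "q > 0" using that r by auto
    from has_vector_derivative_scaleR[OF DERIV_const poisson_has_vector_derivative[OF this f that(2)], of "K s x y" k]
    show ?thesis by simp
  qed
  show "(\<lambda>y. K s x y *\<^sub>R poisson (Suc k) r f y) \<in> borel_measurable M" using x by measurable
  show "integrable M (\<lambda>y. K s x y * (eta_const (Suc k) * (r / 2) powr (- real (Suc k)) * \<bar>B\<bar>))"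
    using integrable_kernel[OF s x] by simp
  show "norm (K s x y *\<^sub>R poisson (Suc k) q f y) \<le> K s x y * (eta_const (Suc k) * (r / 2) powr (- real (Suc k)) * \<bar>B\<bar>)"
    if q: "q \<in> {r / 2<..}" and y: "y \<in> space M" for q y
  proof -
    have "q > 0" using q r by auto
    note norm_poisson_le[OF this bounded_by_abs[OF f] y, of "Suc k"]
    also have "eta_const (Suc k) * q powr (- real (Suc k)) * \<bar>B\<bar> \<le> eta_const (Suc k) * (r / 2) powr (- real (Suc k)) * \<bar>B\<bar>"
      using q r eta_const_pos[of "Suc k"] by (intro mult_mono powr_mono2') auto
    finally show ?thesis using kernel_nonneg[OF s x y] by (auto intro!: mult_left_mono)
  qed
qed (use r in auto)

lemma poisson_poisson_has_vector_derivative: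
  assumes t: "t > 0" and r: "r > 0" and x: "x \<in> space M" and f: "bounded_by B f"
  shows "((\<lambda>r. poisson 0 t (poisson k r f) x) has_vector_derivative poisson 0 t (poisson (Suc k) r f) x) (at r)"
  unfolding poisson_def[of 0 t]
proof (rule has_vector_derivative_lebesgue_integral[where T="{r / 2<..}"])
  have [measurable]: "f \<in> borel_measurable M" using f by (simp add: bounded_by_def)
  show "integrable lborel (\<lambda>s. eta 0 t s *\<^sub>R heat s (poisson k q f) x)" if "q \<in> {r / 2<..}" for q
    using that r by (intro integrable_eta_scaleR(1)[OF t bounded_heat[OF bounded_poisson[OF _ f] x]]) auto
  show "((\<lambda>q. eta 0 t s *\<^sub>R heat s (poisson k q f) x) has_vector_derivative
      eta 0 t s *\<^sub>R heat s (poisson (Suc k) q f) x) (at q)"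
    if "q \<in> {r / 2<..}" for q s
  proof (cases "s > 0")
    case True
    have "q > 0" using that r by auto
    from has_vector_derivative_scaleR[OF DERIV_const heat_poisson_has_vector_derivative[OF True this x f], of "eta 0 t s" k]
    show ?thesis by simp
  qed simp
  show "(\<lambda>s. eta 0 t s *\<^sub>R heat s (poisson (Suc k) r f) x) \<in> borel_measurable lborel" using x by measurable
  show "integrable lborel (\<lambda>s. eta 0 t s * (eta_const (Suc k) * (r / 2) powr (- real (Suc k)) * \<bar>B\<bar>))"
    using integrable_eta_0[OF t] by simp
  show "norm (eta 0 t s *\<^sub>R heat s (poisson (Suc k) q f) x) \<le>
      eta 0 t s * (eta_const (Suc k) * (r / 2) powr (- real (Suc k)) * \<bar>B\<bar>)"
    if q: "q \<in> {r / 2<..}" for q s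
  proof (cases "s > 0")
    case True
    have q0: "q > 0" using q r by auto
    note integrable_kernel_scaleR(2)[OF True x bounded_poisson[OF q0 bounded_by_abs[OF f], of "Suc k"]]
    also have "eta_const (Suc k) * q powr (- real (Suc k)) * \<bar>B\<bar> \<le> eta_const (Suc k) * (r / 2) powr (- real (Suc k)) * \<bar>B\<bar>"
      using q r eta_const_pos[of "Suc k"] by (intro mult_mono powr_mono2') auto
    finally show ?thesis using eta_0_nonneg[OF t] by (auto intro!: mult_left_mono)
  qed simp
qed (use r in auto)

text \<open>The case without derivatives is differentiated repeatedly, first in \<open>r\<close> to
  raise \<open>k\<close>, then in \<open>t\<close> to raise \<open>j\<close>. At each stage both
  sides are derivatives of one function on an open set of times, so uniqueness of derivatives
  applies.\<close>

lemma poisson_add: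
  assumes t: "t > 0" and r: "r > 0" and x: "x \<in> space M" and f: "bounded_by B f"
  shows "poisson (j + k) (t + r) f x = poisson j t (poisson k r f) x"
proof -
  have k: "poisson k (t + r) f x = poisson 0 t (poisson k r f) x" if t: "t > 0" and r: "r > 0" for t r
    using r
  proof (induction k arbitrary: r)
    case 0
    then show ?case by (rule poisson_add_0[OF t _ x f])
  next
    case (Suc k)
    have "((\<lambda>r. poisson k (t + r) f x) has_vector_derivative poisson (Suc k) (t + r) f x) (at r)"
      using poisson_shift_has_vector_derivative[OF _ f x, of t r k] t Suc.prems by simp
    then have "((\<lambda>r. poisson 0 t (poisson k r f) x) has_vector_derivative poisson (Suc k) (t + r) f x) (at r)"
      by (rule has_vector_derivative_transform_within_open[where S="{0<..}"]) (use Suc in auto)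
    then show ?case
      using poisson_poisson_has_vector_derivative[OF t Suc.prems x f] by (rule vector_derivative_unique_at)
  qed
  show ?thesis
    using t
  proof (induction j arbitrary: t)
    case 0
    then show ?case using k[OF _ r] by simp
  next
    case (Suc j)
    have "((\<lambda>t. poisson (j + k) (t + r) f x) has_vector_derivative poisson (Suc j + k) (t + r) f x) (at t)"
      using poisson_shift_has_vector_derivative[OF _ f x, of r t "j + k"] r Suc.prems by (simp add: add.commute)
    then have "((\<lambda>t. poisson j t (poisson k r f) x) has_vector_derivative poisson (Suc j + k) (t + r) f x) (at t)"
      by (rule has_vector_derivative_transform_within_open[where S="{0<..}"]) (use Suc in auto)
    then show ?case
      using poisson_has_vector_derivative[OF Suc.prems bounded_poisson[OF r f] x] by (rule vector_derivative_unique_at)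
  qed
qed

section \<open>Comparison of growth bounds for different orders of differentiation\<close>

definition poisson_bound :: "real \<Rightarrow> nat \<Rightarrow> ('a \<Rightarrow> complex) \<Rightarrow> real \<Rightarrow> bool" where
  "poisson_bound \<beta> k f A \<longleftrightarrow> (\<forall>t>0. AE x in M. norm (poisson k t f x) \<le> A * t powr (- real k + \<beta>))"

text \<open>Time is split into two halves. The derivative of order \<open>k\<close> at
  \<open>t / 2\<close> is treated as bounded data for the operator of order \<open>j\<close>; the
  factor \<open>2 powr (real (j + k) - \<beta>)\<close> is the price of replacing
  \<open>t / 2\<close> by \<open>t\<close>.\<close>

lemma poisson_bound_up:
  assumes f: "bounded_by B f" and A: "poisson_bound \<beta> k f A"
  shows "poisson_bound \<beta> (j + k) f (eta_const j * 2 powr (real (j + k) - \<beta>) * A)"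
  unfolding poisson_bound_def
proof (intro allI impI AE_I2)
  fix t :: real and x assume t: "t > 0" and x: "x \<in> space M"
  have t2: "t / 2 > 0" using t by simp
  have [measurable]: "f \<in> borel_measurable M" using f by (simp add: bounded_by_def)
  \<comment> \<open>From here on the data is bounded in terms of \<open>A\<close> alone, so
    \<open>B\<close> does not reach the final constant.\<close>
  have "bounded_by (A * (t / 2) powr (- real k + \<beta>)) (poisson k (t / 2) f)"
    using A t2 unfolding bounded_by_def poisson_bound_def by auto
  from norm_poisson_le[OF t2 this x, of j]
  have "norm (poisson (j + k) t f x) \<le> eta_const j * (t / 2) powr (- real j) * (A * (t / 2) powr (- real k + \<beta>))"
    using poisson_add[OF t2 t2 x f, of j k] by simp
  also have "\<dots> = eta_const j * A * ((t / 2) powr (- real j) * (t / 2) powr (- real k + \<beta>))"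
    by simp
  also have "(t / 2) powr (- real j) * (t / 2) powr (- real k + \<beta>) = (t / 2) powr (- real (j + k) + \<beta>)"
    by (simp add: algebra_simps flip: powr_add)
  also have "\<dots> = 2 powr (real (j + k) - \<beta>) * t powr (- real (j + k) + \<beta>)"
  proof -
    have "(t / 2) powr e = 2 powr (- e) * t powr e" for e
      using t by (simp add: powr_divide powr_minus_divide)
    from this[of "- real (j + k) + \<beta>"] show ?thesis by (simp add: add.commute)
  qed
  finally show "norm (poisson (j + k) t f x) \<le> eta_const j * 2 powr (real (j + k) - \<beta>) * A * t powr (- real (j + k) + \<beta>)"
    by (simp add: mult_ac)
qed

text \<open>Moves the quantifier over times inside the almost everywhere statement: countably many
  rational times share one null set, and continuity in time extends the bound to all times.\<close>

lemma poisson_bound_all: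
  assumes f: "bounded_by B f" and A: "poisson_bound \<beta> k f A"
  shows "AE x in M. \<forall>t>0. norm (poisson k t f x) \<le> A * t powr (- real k + \<beta>)"
proof -
  have "AE x in M. \<forall>q\<in>{q::rat. q > 0}. norm (poisson k (of_rat q) f x) \<le> A * of_rat q powr (- real k + \<beta>)"
    using A by (subst AE_ball_countable) (auto simp: poisson_bound_def)
  then show ?thesis
  proof (rule AE_mp, intro AE_I2 impI allI)
    fix x and t :: real
    assume x: "x \<in> space M" and t: "t > 0"
      and *: "\<forall>q\<in>{q::rat. q > 0}. norm (poisson k (of_rat q) f x) \<le> A * of_rat q powr (- real k + \<beta>)"
    show "norm (poisson k t f x) \<le> A * t powr (- real k + \<beta>)"
    \<comment> \<open>A violation at \<open>t\<close> is strict, hence by continuity persists at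
      nearby times, including a rational one.\<close>
    proof (rule ccontr)
      define h where "h s = A * s powr (- real k + \<beta>) - norm (poisson k s f x)" for s
      assume "\<not> ?thesis"
      then have "h t < 0" by (simp add: h_def)
      moreover have "isCont h t"
        unfolding h_def
        using t has_vector_derivative_continuous[OF poisson_has_vector_derivative[OF t f x, of k]]
        by (intro continuous_intros) auto
      ultimately have "\<forall>\<^sub>F s in nhds t. h s < 0"
        unfolding isCont_def tendsto_at_iff_tendsto_nhds by (rule order_tendstoD(2)[rotated])
      then obtain e where e: "e > 0" "\<And>s. dist s t < e \<Longrightarrow> h s < 0"
        unfolding eventually_nhds_metric by auto
      obtain q :: rat where q: "t < of_rat q" "of_rat q < t + e"
        using of_rat_dense[of t "t + e"] e(1) by auto
      then have "q > 0" using t by (metis less_trans zero_less_of_rat_iff)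
      with * e(2)[of "of_rat q"] q show False by (auto simp: dist_real_def h_def)
    qed
  qed
qed

lemma poisson_bound_down:
  assumes f: "bounded_by B f" and \<beta>: "0 < \<beta>" "\<beta> < real l" and A: "poisson_bound \<beta> (Suc l) f A"
  shows "poisson_bound \<beta> l f (1 / (real l - \<beta>) * A)"
  unfolding poisson_bound_def
proof (intro allI impI)
  fix t :: real assume t: "t > 0"
  show "AE x in M. norm (poisson l t f x) \<le> 1 / (real l - \<beta>) * A * t powr (- real l + \<beta>)"
    using poisson_bound_all[OF f A]
  proof (rule AE_mp, intro AE_I2 impI)
    fix x assume x: "x \<in> space M"
      and bd: "\<forall>t>0. norm (poisson (Suc l) t f x) \<le> A * t powr (- real (Suc l) + \<beta>)"
    \<comment> \<open>An antiderivative of the bound for order \<open>Suc l\<close>, normalised to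
      vanish at infinity, as is possible because \<open>\<beta> < real l\<close>.\<close>
    define \<phi> where "\<phi> s = - (1 / (real l - \<beta>) * A) * s powr (- real l + \<beta>)" for s
    have \<phi>': "(\<phi> has_vector_derivative A * s powr (- real (Suc l) + \<beta>)) (at s)" if "s > 0" for s
    proof -
      have "(\<phi> has_real_derivative - (1 / (real l - \<beta>) * A) * ((- real l + \<beta>) * s powr (- real l + \<beta> - 1))) (at s)"
        unfolding \<phi>_def[abs_def] using that \<beta> by (auto intro!: derivative_eq_intros)
      also have "- (1 / (real l - \<beta>) * A) * ((- real l + \<beta>) * s powr (- real l + \<beta> - 1)) = A * s powr (- real (Suc l) + \<beta>)"
      proof -
        have "- real l + \<beta> - 1 = - real (Suc l) + \<beta>" by simp
        moreover have "- (1 / d * A) * (- d * X) = A * X" if "d \<noteq> 0" for d X :: real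
          using that by simp
        from this[of "real l - \<beta>"] have "- (1 / (real l - \<beta>) * A) * ((- real l + \<beta>) * X) = A * X" for X
          using \<beta> by simp
        ultimately show ?thesis by (simp only:)
      qed
      finally show ?thesis by (simp add: has_real_derivative_iff_has_vector_derivative)
    qed
    have "norm (poisson l t f x) \<le> eta_const l * T powr (- real l) * B + \<phi> T - \<phi> t" if T: "T > t" for T
    proof -
      have "norm (poisson l T f x - poisson l t f x) \<le> \<phi> T - \<phi> t"
      proof (rule differentiable_bound_general[OF T])
        show "continuous_on {t..T} (\<lambda>s. poisson l s f x)"
          using t by (auto intro!: continuous_at_imp_continuous_on has_vector_derivative_continuous[OF poisson_has_vector_derivative[OF _ f x]])
        show "continuous_on {t..T} \<phi>"
          using t by (auto intro!: continuous_at_imp_continuous_on has_vector_derivative_continuous[OF \<phi>'])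
        show "((\<lambda>s. poisson l s f x) has_vector_derivative poisson (Suc l) s f x) (at s)" if "t < s" "s < T" for s
          using that t by (intro poisson_has_vector_derivative[OF _ f x]) auto
        show "(\<phi> has_vector_derivative A * s powr (- real (Suc l) + \<beta>)) (at s)" if "t < s" "s < T" for s
          using that t by (intro \<phi>') auto
        show "norm (poisson (Suc l) s f x) \<le> A * s powr (- real (Suc l) + \<beta>)" if "t < s" "s < T" for s
          using that t bd by auto
      qed
      moreover have "norm (poisson l T f x) \<le> eta_const l * T powr (- real l) * B"
        using T t by (intro norm_poisson_le[OF _ f x]) auto
      ultimately show ?thesis
        using norm_triangle_ineq2[of "poisson l t f x" "poisson l T f x"] by (simp add: norm_minus_commute)
    qed
    then have ev: "\<forall>\<^sub>F T in at_top. norm (poisson l t f x) \<le> eta_const l * T powr (- real l) * B + \<phi> T - \<phi> t"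
      using eventually_gt_at_top[of t] by (rule eventually_mono[rotated])
    \<comment> \<open>As \<open>T\<close> tends to infinity the boundary term carrying
      \<open>B\<close> disappears, since \<open>l > 0\<close>, and only \<open>- \<phi> t\<close> is
      left.\<close>
    have "((\<lambda>T. eta_const l * T powr (- real l) * B + \<phi> T - \<phi> t) \<longlongrightarrow> eta_const l * 0 * B + - (1 / (real l - \<beta>) * A) * 0 - \<phi> t) at_top"
      unfolding \<phi>_def using \<beta> by (intro tendsto_intros tendsto_neg_powr filterlim_ident) auto
    from tendsto_lowerbound[OF this ev]
    show "norm (poisson l t f x) \<le> 1 / (real l - \<beta>) * A * t powr (- real l + \<beta>)"
      by (simp add: \<phi>_def)
  qed
qed

text \<open>The order of quantifiers is the point: one \<open>C\<close> serves all \<open>B\<close>,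
  \<open>f\<close> and \<open>A\<close>. Raising the order takes a single step, while lowering it
  proceeds one order at a time.\<close>

lemma poisson_bound_transfer:
  assumes \<beta>: "0 < \<beta>" "\<beta> < real k" "\<beta> < real l"
  shows "\<exists>C>0. \<forall>B f A. bounded_by B f \<longrightarrow> poisson_bound \<beta> k f A \<longrightarrow> poisson_bound \<beta> l f (C * A)"
proof (cases "k \<le> l")
  case True
  then obtain j where l: "l = j + k" using le_Suc_ex[of k l] by (auto simp: add.commute)
  show ?thesis
  proof (intro exI[of _ "eta_const j * 2 powr (real (j + k) - \<beta>)"] conjI allI impI)
    show "eta_const j * 2 powr (real (j + k) - \<beta>) > 0"
      using eta_const_pos[of j] by simp
  qed (unfold l, rule poisson_bound_up)
next
  case False
  then have "l \<le> k" by simp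
  \<comment> \<open>The induction starts at \<open>l\<close>, so every intermediate order
    \<open>m\<close> satisfies \<open>m \<ge> l > \<beta>\<close>; each descent contributes a factor
    \<open>1 / (real m - \<beta>)\<close>.\<close>
  then show ?thesis
    using \<beta>(2)
  proof (induction k rule: dec_induct)
    case base
    show ?case by (rule exI[of _ 1]) simp
  next
    case (step m)
    have m: "\<beta> < real m" using step.hyps \<beta>(3) by simp
    then obtain C where C: "C > 0" "\<And>B f A. bounded_by B f \<Longrightarrow> poisson_bound \<beta> m f A \<Longrightarrow> poisson_bound \<beta> l f (C * A)"
      using step.IH by blast
    show ?case
    proof (intro exI[of _ "C * (1 / (real m - \<beta>))"] conjI allI impI)
      fix B f A assume f: "bounded_by B f" and A: "poisson_bound \<beta> (Suc m) f A"
      show "poisson_bound \<beta> l f (C * (1 / (real m - \<beta>)) * A)"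
        using C(2)[OF f poisson_bound_down[OF f \<beta>(1) m A]] by (simp only: mult.assoc)
    qed (use C m in simp)
  qed
qed

end

section \<open>Weber's exponential integral\<close>

lemma suminf_ennreal_swap:
  fixes f :: "nat \<Rightarrow> nat \<Rightarrow> ennreal"
  shows "(\<Sum>i. \<Sum>j. f i j) = (\<Sum>j. \<Sum>i. f i j)"
  using nn_integral_suminf[of f "count_space UNIV"] by (simp add: nn_integral_count_space_nat)

lemma suminf_ennreal_shift:
  fixes g :: "nat \<Rightarrow> ennreal"
  shows "(\<Sum>m. if k \<le> m then g (m - k) else 0) = (\<Sum>i. g i)"
  by (subst suminf_offset[of _ k]) auto

text \<open>The regularised hypergeometric function 0F1 with parameter \<open>\<alpha> + 1\<close>:
  for positive z, \<open>bessel_I \<alpha> z\<close> equals (z / 2) powr \<open>\<alpha>\<close>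
  times this series at (z / 2)^2. Splitting off the power leaves integer exponents only, and the
  value at 0 makes sense.\<close>

definition bessel_series :: "real \<Rightarrow> real \<Rightarrow> real" where
  "bessel_series \<alpha> c = (\<Sum>m. c ^ m / (fact m * Gamma (real m + \<alpha> + 1)))"

lemma bessel_series_term_nonneg:
  "\<alpha> > -1 \<Longrightarrow> c \<ge> 0 \<Longrightarrow> 0 \<le> c ^ m / (fact m * Gamma (real m + \<alpha> + 1))"
  by (intro divide_nonneg_nonneg mult_nonneg_nonneg less_imp_le[OF Gamma_real_pos]) auto

lemma summable_bessel_series:
  assumes "\<alpha> > -1" "c \<ge> 0"
  shows "summable (\<lambda>m. c ^ m / (fact m * Gamma (real m + \<alpha> + 1)))"
\<comment> \<open>Beyond this index the ratio of successive terms,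
  \<open>c / ((n + 1) * (n + \<alpha> + 1))\<close>, is at most 1/2.\<close>
proof (rule summable_ratio_test[of "1/2" "nat \<lceil>2 * c + 1\<rceil>"])
  fix n assume "n \<ge> nat \<lceil>2 * c + 1\<rceil>"
  then have n: "real n \<ge> 2 * c + 1" by linarith
  let ?a = "\<lambda>m. c ^ m / (fact m * Gamma (real m + \<alpha> + 1))"
  have pos: "real n + \<alpha> + 1 > 0" using assms by simp
  have G: "Gamma (real (Suc n) + \<alpha> + 1) = (real n + \<alpha> + 1) * Gamma (real n + \<alpha> + 1)"
    using Gamma_plus1[of "real n + \<alpha> + 1"] pos by (force simp: add_ac elim!: nonpos_Ints_cases)
  have "2 * c * 1 \<le> (real n + \<alpha> + 1) * (real n + 1)"
    using n assms by (intro mult_mono) auto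
  then have "c / ((real n + 1) * (real n + \<alpha> + 1)) \<le> 1 / 2"
    using pos by (simp add: divide_simps mult.commute)
  then have "c / ((real n + 1) * (real n + \<alpha> + 1)) * ?a n \<le> 1 / 2 * ?a n"
    using bessel_series_term_nonneg[OF assms, of n] by (rule mult_right_mono)
  moreover have "?a (Suc n) = c / ((real n + 1) * (real n + \<alpha> + 1)) * ?a n"
    unfolding G by (simp add: add_ac mult_ac)
  ultimately have "?a (Suc n) \<le> 1 / 2 * ?a n" by (simp only:)
  then show "norm (?a (Suc n)) \<le> 1 / 2 * norm (?a n)"
    by (simp only: real_norm_def abs_of_nonneg[OF bessel_series_term_nonneg[OF assms]])
qed simp

lemma bessel_series_nonneg: "\<alpha> > -1 \<Longrightarrow> c \<ge> 0 \<Longrightarrow> 0 \<le> bessel_series \<alpha> c"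
  unfolding bessel_series_def by (intro suminf_nonneg summable_bessel_series bessel_series_term_nonneg)

lemma ennreal_bessel_series:
  "\<alpha> > -1 \<Longrightarrow> c \<ge> 0 \<Longrightarrow> ennreal (bessel_series \<alpha> c) = (\<Sum>m. ennreal (c ^ m / (fact m * Gamma (real m + \<alpha> + 1))))"
  unfolding bessel_series_def by (intro suminf_ennreal2[symmetric] summable_bessel_series bessel_series_term_nonneg)

lemma bessel_series_0: "bessel_series \<alpha> 0 = 1 / Gamma (\<alpha> + 1)"
proof -
  have "(\<Sum>m. 0 ^ m / (fact m * Gamma (real m + \<alpha> + 1))) = (\<Sum>m\<in>{0}. 0 ^ m / (fact m * Gamma (real m + \<alpha> + 1)))"
    by (rule suminf_finite) auto
  then show ?thesis by (simp add: bessel_series_def)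
qed

lemma bessel_series_measurable [measurable]: "bessel_series \<alpha> \<in> borel_measurable borel"
  unfolding bessel_series_def[abs_def] by measurable

lemma nn_integral_powr_exp:
  assumes s: "s > -1" and c: "c > 0"
  shows "(\<integral>\<^sup>+y. ennreal (indicator {0<..} y * (y powr s * exp (- c * y))) \<partial>lborel) = ennreal (Gamma (s + 1) * c powr (- s - 1))"
proof -
  have "ennreal (Gamma (s + 1)) = (\<integral>\<^sup>+y. ennreal (indicator {0..} y * y powr s / exp y) \<partial>lborel)"
    using Gamma_conv_nn_integral_real[of "s + 1"] s by simp
  also have "\<dots> = ennreal \<bar>c\<bar> * (\<integral>\<^sup>+y. ennreal (indicator {0..} (0 + c * y) * (0 + c * y) powr s / exp (0 + c * y)) \<partial>lborel)"
    using c by (intro nn_integral_real_affine) auto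
  also have "(\<integral>\<^sup>+y. ennreal (indicator {0..} (0 + c * y) * (0 + c * y) powr s / exp (0 + c * y)) \<partial>lborel) =
      (\<integral>\<^sup>+y. ennreal (c powr s) * ennreal (indicator {0<..} y * (y powr s * exp (- c * y))) \<partial>lborel)"
  proof (intro nn_integral_cong)
    fix y
    show "ennreal (indicator {0..} (0 + c * y) * (0 + c * y) powr s / exp (0 + c * y)) =
        ennreal (c powr s) * ennreal (indicator {0<..} y * (y powr s * exp (- c * y)))"
    proof (cases "y > 0")
      case True
      then show ?thesis using c by (simp add: powr_mult exp_minus divide_inverse mult_ac flip: ennreal_mult)
    next
      case False
      then show ?thesis using c by (cases "y = 0") (auto simp: indicator_def zero_le_mult_iff)
    qed
  qed
  also have "\<dots> = ennreal (c powr s) * (\<integral>\<^sup>+y. ennreal (indicator {0<..} y * (y powr s * exp (- c * y))) \<partial>lborel)"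
    by (intro nn_integral_cmult) measurable
  finally have *: "ennreal (Gamma (s + 1)) = ennreal (c powr (s + 1)) * (\<integral>\<^sup>+y. ennreal (indicator {0<..} y * (y powr s * exp (- c * y))) \<partial>lborel)"
    using c by (simp add: powr_add mult.assoc mult.left_commute ennreal_mult)
  have "ennreal (c powr (- s - 1)) * ennreal (c powr (s + 1)) = 1"
    using c by (simp flip: ennreal_mult powr_add)
  then have "(\<integral>\<^sup>+y. ennreal (indicator {0<..} y * (y powr s * exp (- c * y))) \<partial>lborel) = ennreal (c powr (- s - 1)) * ennreal (Gamma (s + 1))"
    unfolding * by (simp flip: mult.assoc)
  also have "\<dots> = ennreal (Gamma (s + 1) * c powr (- s - 1))"
    using s by (subst ennreal_mult[symmetric]) (auto intro!: less_imp_le[OF Gamma_real_pos] simp: mult.commute)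
  finally show ?thesis .
qed

text \<open>Vandermonde's identity for the binomial coefficient of \<open>m + (n + \<alpha>)\<close>
  over \<open>n\<close>, with every coefficient written through Gamma. The restriction
  \<open>k \<le> m\<close> appears because the ordinary coefficients of \<open>m\<close> vanish
  beyond it.\<close>

lemma Gamma_Vandermonde:
  assumes "\<alpha> > (-1::real)"
  shows "Gamma (real (m + n) + \<alpha> + 1) / (fact m * fact n * Gamma (real m + \<alpha> + 1) * Gamma (real n + \<alpha> + 1))
    = (\<Sum>k | k \<le> m \<and> k \<le> n. 1 / (fact (m - k) * fact (n - k) * fact k * Gamma (real k + \<alpha> + 1)))"
proof -
  have G: "Gamma (real i + \<alpha> + 1) > 0" for i
    using assms by (intro Gamma_real_pos) simp
  have g: "(real i + \<alpha>) gchoose j = Gamma (real i + \<alpha> + 1) / (fact j * Gamma (real (i - j) + \<alpha> + 1))" if "j \<le> i" for i j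
    using that assms by (subst gbinomial_Gamma) (auto simp: of_nat_diff algebra_simps elim!: nonpos_Ints_cases)
  have "Gamma (real (m + n) + \<alpha> + 1) / (fact n * Gamma (real m + \<alpha> + 1)) = (real m + (real n + \<alpha>)) gchoose n"
    using g[of n "m + n"] by (simp add: add_ac)
  also have "\<dots> = (\<Sum>k\<in>{0..n}. (real m gchoose k) * ((real n + \<alpha>) gchoose (n - k)))"
    by (rule gbinomial_Vandermonde[symmetric])
  also have "\<dots> = (\<Sum>k | k \<le> m \<and> k \<le> n. (real m gchoose k) * ((real n + \<alpha>) gchoose (n - k)))"
    by (rule sum.mono_neutral_right) (auto simp: binomial_gbinomial[symmetric])
  also have "\<dots> = (\<Sum>k | k \<le> m \<and> k \<le> n. fact m * Gamma (real n + \<alpha> + 1) * (1 / (fact (m - k) * fact (n - k) * fact k * Gamma (real k + \<alpha> + 1))))"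
    by (rule sum.cong) (auto simp: g binomial_gbinomial[symmetric] binomial_fact divide_simps)
  also have "\<dots> = fact m * Gamma (real n + \<alpha> + 1) * (\<Sum>k | k \<le> m \<and> k \<le> n. 1 / (fact (m - k) * fact (n - k) * fact k * Gamma (real k + \<alpha> + 1)))"
    by (simp only: sum_distrib_left)
  finally show ?thesis
    using G[of n] G[of m] by (simp add: divide_simps mult_ac)
qed

text \<open>Weber's second exponential integral, expanded and resummed with Vandermonde's identity.\<close>

lemma nn_integral_bessel_series_mult:
  assumes \<alpha>: "\<alpha> > -1" and c: "c > 0" and p: "p \<ge> 0" and q: "q \<ge> 0"
  shows "(\<integral>\<^sup>+y. ennreal (indicator {0<..} y * (y powr \<alpha> * exp (- c * y) * bessel_series \<alpha> (p * y) * bessel_series \<alpha> (q * y))) \<partial>lborel)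
    = ennreal (c powr (- \<alpha> - 1) * exp ((p + q) / c) * bessel_series \<alpha> (p * q / c\<^sup>2))"
proof -
  have G: "Gamma (real i + \<alpha> + 1) > 0" for i
    using \<alpha> by (intro Gamma_real_pos) simp
  define a where "a m n = p ^ m * q ^ n / (fact m * fact n * Gamma (real m + \<alpha> + 1) * Gamma (real n + \<alpha> + 1))" for m n
  have a: "a m n \<ge> 0" for m n
    using p q G[of m] G[of n] by (simp add: a_def)
  \<comment> \<open>The summand after the change of indices m = k + i, n = k + j. It separates:
    \<open>k\<close> yields the resulting Bessel series, while \<open>i\<close> and \<open>j\<close>
    yield the exponentials of \<open>p / c\<close> and \<open>q / c\<close>.\<close>
  define X where "X k i j = c powr (- \<alpha> - 1) * ((p * q / c\<^sup>2) ^ k / (fact k * Gamma (real k + \<alpha> + 1))) * ((p / c) ^ i / fact i) * ((q / c) ^ j / fact j)" for k i j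
  have X: "X k i j \<ge> 0" for k i j
    using p q c G[of k] by (simp add: X_def)
  have "ennreal (indicator {0<..} y * (y powr \<alpha> * exp (- c * y) * bessel_series \<alpha> (p * y) * bessel_series \<alpha> (q * y))) =
      (\<Sum>m. \<Sum>n. ennreal (a m n) * ennreal (indicator {0<..} y * (y powr (real (m + n) + \<alpha>) * exp (- c * y))))" for y
  proof (cases "y > 0")
    case y: True
    have "ennreal (indicator {0<..} y * (y powr \<alpha> * exp (- c * y) * bessel_series \<alpha> (p * y) * bessel_series \<alpha> (q * y))) =
        ennreal (y powr \<alpha> * exp (- c * y)) * ennreal (bessel_series \<alpha> (p * y)) * ennreal (bessel_series \<alpha> (q * y))"
      using y p q \<alpha> by (simp add: bessel_series_nonneg flip: ennreal_mult)
    also have "\<dots> = (\<Sum>m. \<Sum>n. ennreal (y powr \<alpha> * exp (- c * y)) * ennreal ((p * y) ^ m / (fact m * Gamma (real m + \<alpha> + 1)))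
         * ennreal ((q * y) ^ n / (fact n * Gamma (real n + \<alpha> + 1))))"
      using y p q \<alpha> by (simp add: ennreal_bessel_series)
    also have "\<dots> = (\<Sum>m. \<Sum>n. ennreal (a m n) * ennreal (indicator {0<..} y * (y powr (real (m + n) + \<alpha>) * exp (- c * y))))"
    proof (intro suminf_cong)
      fix m n
      have "(y powr \<alpha> * exp (- c * y)) * ((p * y) ^ m / (fact m * Gamma (real m + \<alpha> + 1)))
         * ((q * y) ^ n / (fact n * Gamma (real n + \<alpha> + 1))) = a m n * (y powr (real (m + n) + \<alpha>) * exp (- c * y))"
        using y by (simp add: a_def powr_add powr_realpow power_mult_distrib mult_ac)
      then show "ennreal (y powr \<alpha> * exp (- c * y)) * ennreal ((p * y) ^ m / (fact m * Gamma (real m + \<alpha> + 1)))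
         * ennreal ((q * y) ^ n / (fact n * Gamma (real n + \<alpha> + 1))) =
         ennreal (a m n) * ennreal (indicator {0<..} y * (y powr (real (m + n) + \<alpha>) * exp (- c * y)))"
        using y p q a[of m n] G[of m] G[of n] by (simp flip: ennreal_mult)
    qed
    finally show ?thesis .
  qed simp
  then have "(\<integral>\<^sup>+y. ennreal (indicator {0<..} y * (y powr \<alpha> * exp (- c * y) * bessel_series \<alpha> (p * y) * bessel_series \<alpha> (q * y))) \<partial>lborel)
      = (\<Sum>m. \<Sum>n. ennreal (a m n) * (\<integral>\<^sup>+y. ennreal (indicator {0<..} y * (y powr (real (m + n) + \<alpha>) * exp (- c * y))) \<partial>lborel))"
    by (simp only:) (subst nn_integral_suminf nn_integral_cmult, measurable)+
  also have "\<dots> = (\<Sum>m. \<Sum>n. \<Sum>k. if k \<le> m \<and> k \<le> n then ennreal (X k (m - k) (n - k)) else 0)"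
  proof (intro suminf_cong)
    fix m n
    have mn: "real (m + n) + \<alpha> > -1" using \<alpha> by simp
    have "ennreal (a m n) * (\<integral>\<^sup>+y. ennreal (indicator {0<..} y * (y powr (real (m + n) + \<alpha>) * exp (- c * y))) \<partial>lborel)
        = ennreal (a m n * (Gamma (real (m + n) + \<alpha> + 1) * c powr (- (real (m + n) + \<alpha>) - 1)))"
      unfolding nn_integral_powr_exp[OF mn c] using a[of m n] G[of "m + n"] by (subst ennreal_mult) auto
    also have "a m n * (Gamma (real (m + n) + \<alpha> + 1) * c powr (- (real (m + n) + \<alpha>) - 1)) =
        p ^ m * q ^ n * c powr (- (real (m + n) + \<alpha>) - 1) *
        (Gamma (real (m + n) + \<alpha> + 1) / (fact m * fact n * Gamma (real m + \<alpha> + 1) * Gamma (real n + \<alpha> + 1)))"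
      by (simp add: a_def)
    also have "\<dots> = (\<Sum>k | k \<le> m \<and> k \<le> n. X k (m - k) (n - k))"
      unfolding Gamma_Vandermonde[OF \<alpha>] sum_distrib_left
    proof (rule sum.cong[OF refl])
      fix k assume "k \<in> {k. k \<le> m \<and> k \<le> n}"
      then obtain i j where m: "m = k + i" and n: "n = k + j" using le_Suc_ex by blast
      have "c powr (- (real (m + n) + \<alpha>) - 1) = c powr (- \<alpha> - 1) * c powr (- real (m + n))"
        by (simp add: algebra_simps flip: powr_add)
      also have "c powr (- real (m + n)) = 1 / c ^ (m + n)"
        using c by (simp only: powr_minus_divide powr_realpow)
      finally have c_powr: "c powr (- (real (m + n) + \<alpha>) - 1) = c powr (- \<alpha> - 1) * (1 / c ^ (m + n))" .
      show "p ^ m * q ^ n * c powr (- (real (m + n) + \<alpha>) - 1) *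
          (1 / (fact (m - k) * fact (n - k) * fact k * Gamma (real k + \<alpha> + 1))) = X k (m - k) (n - k)"
        unfolding X_def c_powr by (simp add: m n power_add power_divide power_mult_distrib power2_eq_square mult_ac)
    qed
    also have "ennreal \<dots> = (\<Sum>k | k \<le> m \<and> k \<le> n. ennreal (X k (m - k) (n - k)))"
      using X by simp
    also have "\<dots> = (\<Sum>k. if k \<le> m \<and> k \<le> n then ennreal (X k (m - k) (n - k)) else 0)"
      by (subst suminf_finite[of "{k. k \<le> m \<and> k \<le> n}"]) auto
    finally show "ennreal (a m n) * (\<integral>\<^sup>+y. ennreal (indicator {0<..} y * (y powr (real (m + n) + \<alpha>) * exp (- c * y))) \<partial>lborel) =
      (\<Sum>k. if k \<le> m \<and> k \<le> n then ennreal (X k (m - k) (n - k)) else 0)" .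
  qed
  \<comment> \<open>All terms are nonnegative extended reals, so the sums may be interchanged
    without a convergence argument; \<open>k\<close> is brought outermost before \<open>m\<close>
    and \<open>n\<close> are shifted by it.\<close>
  also have "\<dots> = (\<Sum>m. \<Sum>k. \<Sum>n. if k \<le> m \<and> k \<le> n then ennreal (X k (m - k) (n - k)) else 0)"
    by (intro suminf_cong suminf_ennreal_swap)
  also have "\<dots> = (\<Sum>k. \<Sum>m. \<Sum>n. if k \<le> m \<and> k \<le> n then ennreal (X k (m - k) (n - k)) else 0)"
    by (rule suminf_ennreal_swap)
  also have "\<dots> = (\<Sum>k. \<Sum>i. \<Sum>j. ennreal (X k i j))"
  proof (rule suminf_cong)
    fix k
    have "(\<Sum>n. if k \<le> m \<and> k \<le> n then ennreal (X k (m - k) (n - k)) else 0) =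
        (if k \<le> m then (\<Sum>j. ennreal (X k (m - k) j)) else 0)" for m
      using suminf_ennreal_shift[of k "\<lambda>j. ennreal (X k (m - k) j)"] by (cases "k \<le> m") auto
    then show "(\<Sum>m. \<Sum>n. if k \<le> m \<and> k \<le> n then ennreal (X k (m - k) (n - k)) else 0) = (\<Sum>i. \<Sum>j. ennreal (X k i j))"
      using suminf_ennreal_shift[of k "\<lambda>i. \<Sum>j. ennreal (X k i j)"] by simp
  qed
  also have "\<dots> = (\<Sum>k. \<Sum>i. \<Sum>j. ennreal (c powr (- \<alpha> - 1)) * ennreal ((p * q / c\<^sup>2) ^ k / (fact k * Gamma (real k + \<alpha> + 1))) *
      ennreal ((p / c) ^ i / fact i) * ennreal ((q / c) ^ j / fact j))"
    unfolding X_def using p q c G by (intro suminf_cong) (simp add: less_imp_le flip: ennreal_mult)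
  also have "\<dots> = ennreal (c powr (- \<alpha> - 1)) * ennreal (bessel_series \<alpha> (p * q / c\<^sup>2)) *
      ennreal (exp (p / c)) * ennreal (exp (q / c))"
  proof -
    have "(\<Sum>i. z ^ i / fact i) = exp z" "summable (\<lambda>i. z ^ i / fact i)" for z :: real
      using summable_exp[of z] by (simp_all add: exp_def divide_inverse mult.commute)
    then have "(\<Sum>i. ennreal (z ^ i / fact i)) = ennreal (exp z)" if "z \<ge> 0" for z :: real
      using that by (subst suminf_ennreal2) auto
    from this[of "p / c"] this[of "q / c"] show ?thesis
      using p q c \<alpha> by (simp only: ennreal_suminf_cmult ennreal_suminf_multc ennreal_bessel_series
        divide_nonneg_nonneg mult_nonneg_nonneg zero_le_power2 less_imp_le)
  qed
  also have "\<dots> = ennreal (c powr (- \<alpha> - 1) * exp ((p + q) / c) * bessel_series \<alpha> (p * q / c\<^sup>2))"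
    using p q c \<alpha> by (simp add: bessel_series_nonneg exp_add add_divide_distrib mult_ac flip: ennreal_mult)
  finally show ?thesis .
qed

section \<open>The one-dimensional Laguerre kernel\<close>

definition laguerre_density :: "real \<Rightarrow> real \<Rightarrow> real" where
  "laguerre_density \<alpha> y = y powr \<alpha> * exp (- y) / Gamma (\<alpha> + 1)"

definition laguerre_kernel_1 :: "real \<Rightarrow> real \<Rightarrow> real \<Rightarrow> real \<Rightarrow> real" where
  "laguerre_kernel_1 \<alpha> t x y = Gamma (\<alpha> + 1) / (1 - exp (-t))
        * exp (- (exp (-t) / (1 - exp (-t))) * (x + y))
        * sqrt (exp (-t) * x * y) powr (- \<alpha>)
        * bessel_I \<alpha> (2 * sqrt (exp (-t) * x * y) / (1 - exp (-t)))"

lemma laguerre_kernel_prod: "laguerre_kernel \<alpha> t x y = (\<Prod>j\<in>UNIV. laguerre_kernel_1 (\<alpha> $ j) t (x $ j) (y $ j))"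
  by (simp add: laguerre_kernel_def laguerre_kernel_1_def)

lemma bessel_I_measurable [measurable]: "bessel_I \<nu> \<in> borel_measurable borel"
  unfolding bessel_I_def[abs_def] by measurable

lemma laguerre_kernel_1_measurable [measurable (raw)]:
  assumes [measurable]: "a \<in> borel_measurable N" "b \<in> borel_measurable N" "c \<in> borel_measurable N"
  shows "(\<lambda>p. laguerre_kernel_1 \<alpha> (a p) (b p) (c p)) \<in> borel_measurable N"
  unfolding laguerre_kernel_1_def by measurable

lemma laguerre_density_measurable [measurable]: "laguerre_density \<alpha> \<in> borel_measurable borel"
  unfolding laguerre_density_def[abs_def] by measurable

lemma laguerre_density_nonneg: "\<alpha> > -1 \<Longrightarrow> 0 \<le> laguerre_density \<alpha> y"
  unfolding laguerre_density_def by (intro divide_nonneg_nonneg mult_nonneg_nonneg less_imp_le[OF Gamma_real_pos]) auto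

text \<open>The power of z = sqrt (r x y) in front of the Bessel function cancels the one hidden in
  it, leaving \<open>(1 - r) powr (- \<alpha>)\<close>. In this form the kernel matches the
  integrand of Weber's formula.\<close>

lemma laguerre_kernel_1_eq:
  assumes \<alpha>: "\<alpha> > -1" and t: "t > 0" and x: "x > 0" and y: "y > 0"
  defines "r \<equiv> exp (- t)"
  shows "laguerre_kernel_1 \<alpha> t x y = Gamma (\<alpha> + 1) * (1 - r) powr (- \<alpha> - 1) * exp (- (r / (1 - r)) * (x + y))
     * bessel_series \<alpha> (r * x * y / (1 - r)\<^sup>2)"
proof -
  have r: "r > 0" "r < 1" using t by (simp_all add: r_def)
  define z where "z = sqrt (r * x * y)"
  have z: "z > 0" "z\<^sup>2 = r * x * y" using r x y by (simp_all add: z_def)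
  have zr: "z / (1 - r) > 0" using z r by simp
  have summand: "(2 * z / (1 - r) / 2) powr (2 * real m + \<alpha>) / (fact m * Gamma (real m + \<alpha> + 1)) =
      (z / (1 - r)) powr \<alpha> * ((r * x * y / (1 - r)\<^sup>2) ^ m / (fact m * Gamma (real m + \<alpha> + 1)))" for m
  proof -
    have "(z / (1 - r)) powr (2 * real m) = ((z / (1 - r))\<^sup>2) ^ m"
      using powr_realpow[OF zr, of "2 * m"] by (simp add: power_mult)
    moreover have "2 * z / (1 - r) / 2 = z / (1 - r)" using r by (simp add: field_simps)
    ultimately show ?thesis by (simp add: powr_add power_divide[of z] z(2))
  qed
  have "bessel_I \<alpha> (2 * z / (1 - r)) = (z / (1 - r)) powr \<alpha> * bessel_series \<alpha> (r * x * y / (1 - r)\<^sup>2)"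
    unfolding bessel_I_def bessel_series_def summand
    using \<alpha> r x y by (intro suminf_mult summable_bessel_series) auto
  then have "laguerre_kernel_1 \<alpha> t x y = Gamma (\<alpha> + 1) / (1 - r) * exp (- (r / (1 - r)) * (x + y)) * (z powr (- \<alpha>) * (z / (1 - r)) powr \<alpha>)
      * bessel_series \<alpha> (r * x * y / (1 - r)\<^sup>2)"
    unfolding laguerre_kernel_1_def r_def[symmetric] z_def[symmetric] by simp
  also have "z powr (- \<alpha>) * (z / (1 - r)) powr \<alpha> = (1 - r) powr (- \<alpha>)"
    using z r by (simp add: powr_divide powr_minus divide_simps)
  also have "Gamma (\<alpha> + 1) / (1 - r) * exp (- (r / (1 - r)) * (x + y)) * (1 - r) powr (- \<alpha>) * bessel_series \<alpha> (r * x * y / (1 - r)\<^sup>2)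
     = Gamma (\<alpha> + 1) * (1 - r) powr (- \<alpha> - 1) * exp (- (r / (1 - r)) * (x + y)) * bessel_series \<alpha> (r * x * y / (1 - r)\<^sup>2)"
    using r by (simp add: powr_diff)
  finally show ?thesis .
qed

lemma laguerre_kernel_1_nonneg:
  assumes "\<alpha> > -1" "t > 0" "x > 0" "y > 0"
  shows "0 \<le> laguerre_kernel_1 \<alpha> t x y"
  unfolding laguerre_kernel_1_eq[OF assms] using assms
  by (intro mult_nonneg_nonneg bessel_series_nonneg less_imp_le[OF Gamma_real_pos]) auto

lemma nn_integral_laguerre_density:
  assumes \<alpha>: "\<alpha> > -1"
  shows "(\<integral>\<^sup>+y. ennreal (indicator {0<..} y * (laguerre_density \<alpha> y * 1)) \<partial>lborel) = 1"
proof -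
  have G: "Gamma (\<alpha> + 1) > 0" using \<alpha> by simp
  have "(\<integral>\<^sup>+y. ennreal (indicator {0<..} y * (laguerre_density \<alpha> y * 1)) \<partial>lborel)
     = (\<integral>\<^sup>+y. ennreal (1 / Gamma (\<alpha> + 1)) * ennreal (indicator {0<..} y * (y powr \<alpha> * exp (- 1 * y))) \<partial>lborel)"
    using G by (intro nn_integral_cong) (simp add: laguerre_density_def flip: ennreal_mult)
  also have "\<dots> = ennreal (1 / Gamma (\<alpha> + 1)) * ennreal (Gamma (\<alpha> + 1) * 1 powr (- \<alpha> - 1))"
    by (subst nn_integral_cmult) (use nn_integral_powr_exp[OF \<alpha>, of 1] in auto)
  also have "\<dots> = 1" using G by (simp flip: ennreal_mult)
  finally show ?thesis .
qed

text \<open>The degenerate case \<open>q = 0\<close> of Weber's formula: the second Bessel series is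
  then the constant \<open>1 / Gamma (\<alpha> + 1)\<close>, which is the normalisation of the
  density.\<close>

lemma nn_integral_laguerre_kernel_1:
  assumes \<alpha>: "\<alpha> > -1" and t: "t > 0" and x: "x > 0"
  shows "(\<integral>\<^sup>+y. ennreal (indicator {0<..} y * (laguerre_density \<alpha> y * laguerre_kernel_1 \<alpha> t x y)) \<partial>lborel) = 1"
proof -
  define r where "r = exp (- t)"
  have r: "r > 0" "r < 1" using t by (simp_all add: r_def)
  have G: "Gamma (\<alpha> + 1) > 0" using \<alpha> by simp
  define c where "c = 1 / (1 - r)"
  define p where "p = r * x / (1 - r)\<^sup>2"
  define D where "D = Gamma (\<alpha> + 1) * (1 - r) powr (- \<alpha> - 1) * exp (- (r / (1 - r)) * x)"
  have c: "c > 0" and p: "p \<ge> 0" and D: "D > 0" using r x G by (simp_all add: c_def p_def D_def)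
  have "(\<integral>\<^sup>+y. ennreal (indicator {0<..} y * (laguerre_density \<alpha> y * laguerre_kernel_1 \<alpha> t x y)) \<partial>lborel) =
    (\<integral>\<^sup>+y. ennreal D * ennreal (indicator {0<..} y * (y powr \<alpha> * exp (- c * y) * bessel_series \<alpha> (p * y) * bessel_series \<alpha> (0 * y))) \<partial>lborel)"
  proof (intro nn_integral_cong)
    fix y
    show "ennreal (indicator {0<..} y * (laguerre_density \<alpha> y * laguerre_kernel_1 \<alpha> t x y)) =
      ennreal D * ennreal (indicator {0<..} y * (y powr \<alpha> * exp (- c * y) * bessel_series \<alpha> (p * y) * bessel_series \<alpha> (0 * y)))"
    proof (cases "y > 0")
      case y: True
      have "exp (- y) * exp (- (r / (1 - r)) * (x + y)) = exp (- (r / (1 - r)) * x) * exp (- c * y)"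
      proof -
        have "c = 1 + r / (1 - r)" using r by (simp add: c_def field_simps)
        moreover have "- y + - a * (x + y) = - a * x + - (1 + a) * y" for a
          by (simp add: algebra_simps)
        ultimately have "- y + - (r / (1 - r)) * (x + y) = - (r / (1 - r)) * x + - c * y"
          by (simp only:)
        then show ?thesis by (simp only: exp_add[symmetric])
      qed
      moreover have "r * x * y / (1 - r)\<^sup>2 = p * y" by (simp add: p_def)
      ultimately have "laguerre_density \<alpha> y * laguerre_kernel_1 \<alpha> t x y =
         D * (y powr \<alpha> * exp (- c * y) * bessel_series \<alpha> (p * y) * bessel_series \<alpha> (0 * y))"
        using G unfolding laguerre_kernel_1_eq[OF \<alpha> t x y] laguerre_density_def r_def[symmetric]
        by (simp add: bessel_series_0 D_def)
      then show ?thesis using y D by (simp add: ennreal_mult' less_imp_le)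
    qed simp
  qed
  also have "\<dots> = ennreal D * ennreal (c powr (- \<alpha> - 1) * exp ((p + 0) / c) * bessel_series \<alpha> (p * 0 / c\<^sup>2))"
    by (subst nn_integral_cmult) (use nn_integral_bessel_series_mult[OF \<alpha> c p, of 0] in auto)
  also have "\<dots> = ennreal (D * (c powr (- \<alpha> - 1) * exp ((p + 0) / c) * bessel_series \<alpha> (p * 0 / c\<^sup>2)))"
    using D by (simp add: ennreal_mult' less_imp_le)
  also have "D * (c powr (- \<alpha> - 1) * exp ((p + 0) / c) * bessel_series \<alpha> (p * 0 / c\<^sup>2)) = 1"
  proof -
    have "p / c = r / (1 - r) * x" using r by (simp add: p_def c_def power2_eq_square)
    then have "exp (- (r / (1 - r)) * x) * exp (p / c) = 1" by (simp flip: exp_add)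
    moreover have "(1 - r) powr (- \<alpha> - 1) * c powr (- \<alpha> - 1) = 1"
      using r by (simp add: c_def flip: powr_mult)
    moreover have "D * (c powr (- \<alpha> - 1) * exp ((p + 0) / c) * bessel_series \<alpha> (p * 0 / c\<^sup>2)) =
       ((1 - r) powr (- \<alpha> - 1) * c powr (- \<alpha> - 1)) * (exp (- (r / (1 - r)) * x) * exp (p / c))"
      using G by (simp add: D_def bessel_series_0)
    ultimately show ?thesis by (simp only: mult_1)
  qed
  finally show ?thesis by simp
qed

text \<open>Weber's formula in the intermediate variable; prefactors, exponents and Bessel arguments
  recombine into those of a single kernel with r replaced by the product r \<rho>, that is, with the
  times added.\<close>

lemma nn_integral_laguerre_kernel_1_mult:
  assumes \<alpha>: "\<alpha> > -1" and t: "t > 0" and s: "s > 0" and x: "x > 0" and z: "z > 0"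
  shows "(\<integral>\<^sup>+y. ennreal (indicator {0<..} y * (laguerre_density \<alpha> y * (laguerre_kernel_1 \<alpha> t x y * laguerre_kernel_1 \<alpha> s y z))) \<partial>lborel)
    = ennreal (laguerre_kernel_1 \<alpha> (t + s) x z)"
proof -
  define r where "r = exp (- t)"
  define \<rho> where "\<rho> = exp (- s)"
  have r: "r > 0" "r < 1" and \<rho>: "\<rho> > 0" "\<rho> < 1" using t s by (simp_all add: r_def \<rho>_def)
  have r\<rho>: "r * \<rho> = exp (- (t + s))" by (simp add: r_def \<rho>_def flip: exp_add)
  have r\<rho>1: "r * \<rho> < 1" unfolding r\<rho> using t s by simp
  have G: "Gamma (\<alpha> + 1) > 0" using \<alpha> by simp
  \<comment> \<open>The total exponential decay rate in \<open>y\<close>: 1 from the density and one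
    term from each kernel.\<close>
  define c where "c = 1 + r / (1 - r) + \<rho> / (1 - \<rho>)"
  have c_eq: "c = (1 - r * \<rho>) / ((1 - r) * (1 - \<rho>))"
    using r \<rho> by (simp add: c_def field_simps)
  define p where "p = r * x / (1 - r)\<^sup>2"
  define q where "q = \<rho> * z / (1 - \<rho>)\<^sup>2"
  define D where "D = Gamma (\<alpha> + 1) * ((1 - r) powr (- \<alpha> - 1) * (1 - \<rho>) powr (- \<alpha> - 1)) * (exp (- (r / (1 - r)) * x) * exp (- (\<rho> / (1 - \<rho>)) * z))"
  have c: "c > 0" unfolding c_eq using r \<rho> r\<rho>1 by simp
  have p: "p \<ge> 0" and q: "q \<ge> 0" and D: "D > 0" using r \<rho> x z G by (simp_all add: p_def q_def D_def)
  have "(\<integral>\<^sup>+y. ennreal (indicator {0<..} y * (laguerre_density \<alpha> y * (laguerre_kernel_1 \<alpha> t x y * laguerre_kernel_1 \<alpha> s y z))) \<partial>lborel) =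
    (\<integral>\<^sup>+y. ennreal D * ennreal (indicator {0<..} y * (y powr \<alpha> * exp (- c * y) * bessel_series \<alpha> (p * y) * bessel_series \<alpha> (q * y))) \<partial>lborel)"
  proof (intro nn_integral_cong)
    fix y
    show "ennreal (indicator {0<..} y * (laguerre_density \<alpha> y * (laguerre_kernel_1 \<alpha> t x y * laguerre_kernel_1 \<alpha> s y z))) =
      ennreal D * ennreal (indicator {0<..} y * (y powr \<alpha> * exp (- c * y) * bessel_series \<alpha> (p * y) * bessel_series \<alpha> (q * y)))"
    proof (cases "y > 0")
      case y: True
      have e: "exp (- y) * (exp (- (r / (1 - r)) * (x + y)) * exp (- (\<rho> / (1 - \<rho>)) * (y + z))) =
          (exp (- (r / (1 - r)) * x) * exp (- (\<rho> / (1 - \<rho>)) * z)) * exp (- c * y)"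
      proof -
        have "- y + (- a * (x + y) + - b * (y + z)) = (- a * x + - b * z) + - (1 + a + b) * y" for a b
          by (simp add: algebra_simps)
        then have "- y + (- (r / (1 - r)) * (x + y) + - (\<rho> / (1 - \<rho>)) * (y + z)) = (- (r / (1 - r)) * x + - (\<rho> / (1 - \<rho>)) * z) + - c * y"
          unfolding c_def .
        then show ?thesis by (simp only: exp_add[symmetric])
      qed
      have py: "r * x * y / (1 - r)\<^sup>2 = p * y" by (simp add: p_def)
      have qy: "\<rho> * y * z / (1 - \<rho>)\<^sup>2 = q * y" by (simp add: q_def)
      have "laguerre_density \<alpha> y * (laguerre_kernel_1 \<alpha> t x y * laguerre_kernel_1 \<alpha> s y z) =
        Gamma (\<alpha> + 1) * ((1 - r) powr (- \<alpha> - 1) * (1 - \<rho>) powr (- \<alpha> - 1)) * y powr \<alpha> *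
        (exp (- y) * (exp (- (r / (1 - r)) * (x + y)) * exp (- (\<rho> / (1 - \<rho>)) * (y + z)))) *
        (bessel_series \<alpha> (p * y) * bessel_series \<alpha> (q * y))"
        using G unfolding laguerre_kernel_1_eq[OF \<alpha> t x y] laguerre_kernel_1_eq[OF \<alpha> s y z] laguerre_density_def r_def[symmetric] \<rho>_def[symmetric] py qy
        by (simp add: mult_ac)
      then have "laguerre_density \<alpha> y * (laguerre_kernel_1 \<alpha> t x y * laguerre_kernel_1 \<alpha> s y z) =
         D * (y powr \<alpha> * exp (- c * y) * bessel_series \<alpha> (p * y) * bessel_series \<alpha> (q * y))"
        unfolding e D_def by (simp only: mult_ac)
      then show ?thesis using y D by (simp add: ennreal_mult' less_imp_le)
    qed simp
  qed
  also have "\<dots> = ennreal D * ennreal (c powr (- \<alpha> - 1) * exp ((p + q) / c) * bessel_series \<alpha> (p * q / c\<^sup>2))"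
    by (subst nn_integral_cmult) (use nn_integral_bessel_series_mult[OF \<alpha> c p q] in auto)
  also have "\<dots> = ennreal (D * (c powr (- \<alpha> - 1) * exp ((p + q) / c) * bessel_series \<alpha> (p * q / c\<^sup>2)))"
    using D by (simp add: ennreal_mult' less_imp_le)
  also have "D * (c powr (- \<alpha> - 1) * exp ((p + q) / c) * bessel_series \<alpha> (p * q / c\<^sup>2)) = laguerre_kernel_1 \<alpha> (t + s) x z"
  proof -
    have "p * q / c\<^sup>2 = r * \<rho> * x * z / (1 - r * \<rho>)\<^sup>2"
      using r \<rho> r\<rho>1 by (simp add: p_def q_def c_eq power_divide power_mult_distrib)
    moreover have "exp (- (r / (1 - r)) * x) * exp (- (\<rho> / (1 - \<rho>)) * z) * exp ((p + q) / c) = exp (- (r * \<rho> / (1 - r * \<rho>)) * (x + z))"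
    proof -
      have "r * (1 - \<rho>) / ((1 - r) * (1 - r * \<rho>)) = r / (1 - r) - r * \<rho> / (1 - r * \<rho>)"
        using r \<rho> r\<rho>1 by (simp add: divide_simps) (simp add: algebra_simps)
      moreover have "p / c = r * (1 - \<rho>) / ((1 - r) * (1 - r * \<rho>)) * x"
        using r \<rho> r\<rho>1 by (simp add: p_def c_eq power2_eq_square)
      moreover have "\<rho> * (1 - r) / ((1 - \<rho>) * (1 - r * \<rho>)) = \<rho> / (1 - \<rho>) - r * \<rho> / (1 - r * \<rho>)"
        using r \<rho> r\<rho>1 by (simp add: divide_simps) (simp add: algebra_simps)
      moreover have "q / c = \<rho> * (1 - r) / ((1 - \<rho>) * (1 - r * \<rho>)) * z"
        using r \<rho> r\<rho>1 by (simp add: q_def c_eq power2_eq_square)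
      moreover have "- a * x + - b * z + ((a - w) * x + (b - w) * z) = - w * (x + z)" for a b w :: real
        by (simp add: algebra_simps)
      ultimately have "- (r / (1 - r)) * x + - (\<rho> / (1 - \<rho>)) * z + (p + q) / c = - (r * \<rho> / (1 - r * \<rho>)) * (x + z)"
        by (simp only: add_divide_distrib)
      then show ?thesis by (simp only: exp_add[symmetric])
    qed
    moreover have "(1 - r) powr (- \<alpha> - 1) * (1 - \<rho>) powr (- \<alpha> - 1) * c powr (- \<alpha> - 1) = (1 - r * \<rho>) powr (- \<alpha> - 1)"
      using r \<rho> r\<rho>1 c by (simp add: c_eq flip: powr_mult)
    moreover have "D * (c powr (- \<alpha> - 1) * exp ((p + q) / c) * bessel_series \<alpha> (p * q / c\<^sup>2)) =
      Gamma (\<alpha> + 1) * ((1 - r) powr (- \<alpha> - 1) * (1 - \<rho>) powr (- \<alpha> - 1) * c powr (- \<alpha> - 1)) *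
      (exp (- (r / (1 - r)) * x) * exp (- (\<rho> / (1 - \<rho>)) * z) * exp ((p + q) / c)) * bessel_series \<alpha> (p * q / c\<^sup>2)"
      by (simp add: D_def)
    moreover have "laguerre_kernel_1 \<alpha> (t + s) x z = Gamma (\<alpha> + 1) * (1 - r * \<rho>) powr (- \<alpha> - 1) * exp (- (r * \<rho> / (1 - r * \<rho>)) * (x + z))
        * bessel_series \<alpha> (r * \<rho> * x * z / (1 - r * \<rho>)\<^sup>2)"
      unfolding r\<rho> using t s by (intro laguerre_kernel_1_eq[OF \<alpha> _ x z]) simp
    ultimately show ?thesis by (simp only:)
  qed
  finally show ?thesis .
qed

section \<open>The Laguerre measure and kernel on the orthant\<close>

text \<open>Lebesgue measure factorises over \<open>Basis\<close>, the kernel and the weight over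
  coordinates; this translates between the two products.\<close>

lemma prod_Basis_vec:
  fixes x :: "real^'d"
  shows "(\<Prod>b\<in>Basis. f (axis_index b) (x \<bullet> b)) = (\<Prod>i\<in>UNIV. f i (x $ i))"
proof -
  have B: "Basis = (\<lambda>i. axis i 1 :: real^'d) ` UNIV"
    by (auto simp: Basis_vec_def)
  have i: "inj (\<lambda>i. axis i 1 :: real^'d)"
    by (auto simp: inj_on_def axis_eq_axis)
  show ?thesis
    unfolding B prod.reindex[OF i] by (simp add: inner_axis)
qed

lemma measurable_vec_nth [measurable (raw)]:
  fixes f :: "'a \<Rightarrow> real^'d"
  assumes "f \<in> borel_measurable N"
  shows "(\<lambda>p. f p $ j) \<in> borel_measurable N"
  by (rule measurable_compose[OF assms borel_measurable_continuous_onI]) (intro continuous_intros)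

lemma orthant_measurable [measurable]: "(orthant :: (real^'d) set) \<in> sets borel"
proof -
  have "orthant = (\<Inter>i. {x::real^'d. 0 < x $ i})"
    by (auto simp: orthant_def)
  also have "\<dots> \<in> sets borel"
    by (intro borel_open open_INT) (auto intro!: open_Collect_less continuous_intros)
  finally show ?thesis .
qed

lemma space_orthant_lborel [simp]: "space orthant_lborel = orthant"
  by (simp add: orthant_lborel_def space_restrict_space)

lemma space_laguerre_measure [simp]: "space (laguerre_measure \<alpha>) = orthant"
  by (simp add: laguerre_measure_def)

lemma sets_laguerre_measure [measurable_cong]: "sets (laguerre_measure \<alpha>) = sets orthant_lborel"
  by (simp add: laguerre_measure_def)

lemma borel_measurable_orthant_lborel: "f \<in> borel_measurable borel \<Longrightarrow> f \<in> borel_measurable orthant_lborel"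
  unfolding orthant_lborel_def by (intro measurable_restrict_space1) simp

lemma laguerre_weight_eq:
  "(\<Prod>i\<in>UNIV. (x $ i) powr (\<alpha> $ i) * exp (- (x $ i)) / Gamma (\<alpha> $ i + 1)) = (\<Prod>i\<in>UNIV. laguerre_density (\<alpha> $ i) (x $ i))"
  by (simp add: laguerre_density_def)

lemma nn_integral_laguerre_prod:
  fixes \<alpha> :: "real^'d"
  assumes \<alpha>: "\<And>i. \<alpha> $ i > -1" and g [measurable]: "\<And>i. g i \<in> borel_measurable borel"
    and nonneg: "\<And>i y. y > 0 \<Longrightarrow> 0 \<le> g i y"
  shows "(\<integral>\<^sup>+y. ennreal (\<Prod>i\<in>UNIV. g i (y $ i)) \<partial>laguerre_measure \<alpha>) =
    (\<Prod>i\<in>UNIV. \<integral>\<^sup>+y. ennreal (indicator {0<..} y * (laguerre_density (\<alpha> $ i) y * g i y)) \<partial>lborel)"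
proof -
  let ?w = "\<lambda>x::real^'d. \<Prod>i\<in>UNIV. laguerre_density (\<alpha> $ i) (x $ i)"
  have "(\<integral>\<^sup>+y. ennreal (\<Prod>i\<in>UNIV. g i (y $ i)) \<partial>laguerre_measure \<alpha>) =
      (\<integral>\<^sup>+y. ennreal (?w y) * ennreal (\<Prod>i\<in>UNIV. g i (y $ i)) \<partial>orthant_lborel)"
    unfolding laguerre_measure_def laguerre_weight_eq
    by (intro nn_integral_density borel_measurable_orthant_lborel) measurable
  also have "\<dots> = (\<integral>\<^sup>+y. ennreal (?w y) * ennreal (\<Prod>i\<in>UNIV. g i (y $ i)) * indicator orthant y \<partial>lborel)"
    unfolding orthant_lborel_def by (intro nn_integral_restrict_space) simp
  also have "\<dots> = (\<integral>\<^sup>+(y::real^'d). (\<Prod>b\<in>Basis. (\<lambda>i y. ennreal (indicator {0<..} y * (laguerre_density (\<alpha> $ i) y * g i y))) (axis_index b) (y \<bullet> b)) \<partial>lborel)"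
  proof (intro nn_integral_cong)
    fix y :: "real^'d"
    have "ennreal (?w y) * ennreal (\<Prod>i\<in>UNIV. g i (y $ i)) * indicator orthant y =
        (\<Prod>i\<in>UNIV. ennreal (indicator {0<..} (y $ i) * (laguerre_density (\<alpha> $ i) (y $ i) * g i (y $ i))))"
    proof (cases "y \<in> orthant")
      case True
      then have y: "y $ i > 0" for i by (simp add: orthant_def)
      have "ennreal (?w y) * ennreal (\<Prod>i\<in>UNIV. g i (y $ i)) = ennreal (\<Prod>i\<in>UNIV. laguerre_density (\<alpha> $ i) (y $ i) * g i (y $ i))"
        using y \<alpha> nonneg by (simp add: prod.distrib ennreal_mult prod_nonneg laguerre_density_nonneg)
      also have "\<dots> = (\<Prod>i\<in>UNIV. ennreal (laguerre_density (\<alpha> $ i) (y $ i) * g i (y $ i)))"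
        using y \<alpha> nonneg by (intro prod_ennreal[symmetric]) (simp add: laguerre_density_nonneg)
      finally show "ennreal (?w y) * ennreal (\<Prod>i\<in>UNIV. g i (y $ i)) * indicator orthant y =
        (\<Prod>i\<in>UNIV. ennreal (indicator {0<..} (y $ i) * (laguerre_density (\<alpha> $ i) (y $ i) * g i (y $ i))))"
        using True y by simp
    next
      case False
      then obtain i where "\<not> y $ i > 0" by (auto simp: orthant_def)
      then have "(\<Prod>i\<in>UNIV. ennreal (indicator {0<..} (y $ i) * (laguerre_density (\<alpha> $ i) (y $ i) * g i (y $ i)))) = 0"
        by (intro prod_zero bexI[of _ i]) auto
      then show "ennreal (?w y) * ennreal (\<Prod>i\<in>UNIV. g i (y $ i)) * indicator orthant y =
        (\<Prod>i\<in>UNIV. ennreal (indicator {0<..} (y $ i) * (laguerre_density (\<alpha> $ i) (y $ i) * g i (y $ i))))"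
        using False by simp
    qed
    also have "\<dots> = (\<Prod>b\<in>Basis. (\<lambda>i y. ennreal (indicator {0<..} y * (laguerre_density (\<alpha> $ i) y * g i y))) (axis_index b) (y \<bullet> b))"
      by (rule prod_Basis_vec[symmetric])
    finally show "ennreal (?w y) * ennreal (\<Prod>i\<in>UNIV. g i (y $ i)) * indicator orthant y =
      (\<Prod>b\<in>Basis. (\<lambda>i y. ennreal (indicator {0<..} y * (laguerre_density (\<alpha> $ i) y * g i y))) (axis_index b) (y \<bullet> b))" .
  qed
  also have "\<dots> = (\<Prod>b\<in>(Basis :: (real^'d) set). \<integral>\<^sup>+y. ennreal (indicator {0<..} y * (laguerre_density (\<alpha> $ axis_index b) y * g (axis_index b) y)) \<partial>lborel)"
    by (intro nn_integral_lborel_prod) auto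
  also have "\<dots> = (\<Prod>i\<in>UNIV. \<integral>\<^sup>+y. ennreal (indicator {0<..} y * (laguerre_density (\<alpha> $ i) y * g i y)) \<partial>lborel)"
    by (rule prod_Basis_vec[where f="\<lambda>i _. \<integral>\<^sup>+y. ennreal (indicator {0<..} y * (laguerre_density (\<alpha> $ i) y * g i y)) \<partial>lborel"])
  finally show ?thesis .
qed

lemma markov_kernel_laguerre:
  fixes \<alpha> :: "real^'d"
  assumes \<alpha>: "\<And>i. \<alpha> $ i > -1"
  shows "markov_kernel (laguerre_measure \<alpha>) (laguerre_kernel \<alpha>)"
proof -
  \<comment> \<open>The constant 1 is written as a product over coordinates so that the
    factorisation applies. The total mass 1 supplies the sigma-finiteness that the locale asks
    for.\<close>
  have "emeasure (laguerre_measure \<alpha>) (space (laguerre_measure \<alpha>)) = (\<integral>\<^sup>+y. ennreal (\<Prod>i\<in>UNIV. (\<lambda>_ _. 1) i (y $ i)) \<partial>laguerre_measure \<alpha>)"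
    by simp
  also have "\<dots> = 1"
    using \<alpha> by (subst nn_integral_laguerre_prod) (simp_all only: nn_integral_laguerre_density measurable_const prod.neutral_const, simp_all)
  finally interpret finite_measure "laguerre_measure \<alpha>"
    by (intro finite_measureI) simp
  have pos: "x $ i > 0" if "x \<in> space (laguerre_measure \<alpha>)" for x i
    using that by (simp add: orthant_def)
  show ?thesis
  proof
    have "(\<lambda>(s, x, y). laguerre_kernel \<alpha> s x y) \<in> borel_measurable (borel \<Otimes>\<^sub>M borel \<Otimes>\<^sub>M borel)"
      unfolding laguerre_kernel_prod by measurable
    moreover have "(\<lambda>x. x) \<in> laguerre_measure \<alpha> \<rightarrow>\<^sub>M borel"
      using borel_measurable_orthant_lborel[of "\<lambda>x. x"] by (simp add: measurable_cong_sets[OF sets_laguerre_measure refl])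
    then have "(\<lambda>(s, x, y). (s, x, y)) \<in> borel \<Otimes>\<^sub>M laguerre_measure \<alpha> \<Otimes>\<^sub>M laguerre_measure \<alpha> \<rightarrow>\<^sub>M (borel :: real measure) \<Otimes>\<^sub>M borel \<Otimes>\<^sub>M borel"
      by measurable
    ultimately show "(\<lambda>(s, x, y). laguerre_kernel \<alpha> s x y) \<in> borel_measurable (borel \<Otimes>\<^sub>M laguerre_measure \<alpha> \<Otimes>\<^sub>M laguerre_measure \<alpha>)"
      using measurable_compose by (auto simp: split_def)
  next
    fix s x y assume "s > (0::real)" "x \<in> space (laguerre_measure \<alpha>)" "y \<in> space (laguerre_measure \<alpha>)"
    then show "0 \<le> laguerre_kernel \<alpha> s x y"
      unfolding laguerre_kernel_prod using \<alpha> pos by (intro prod_nonneg laguerre_kernel_1_nonneg) auto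
  next
    fix s x assume s: "s > (0::real)" and x: "x \<in> space (laguerre_measure \<alpha>)"
    show "(\<integral>\<^sup>+y. ennreal (laguerre_kernel \<alpha> s x y) \<partial>laguerre_measure \<alpha>) = 1"
      unfolding laguerre_kernel_prod using \<alpha> pos[OF x] s
      by (subst nn_integral_laguerre_prod) (auto intro: laguerre_kernel_1_nonneg simp: nn_integral_laguerre_kernel_1)
  next
    fix s r x z assume s: "s > (0::real)" and r: "r > (0::real)"
      and x: "x \<in> space (laguerre_measure \<alpha>)" and z: "z \<in> space (laguerre_measure \<alpha>)"
    have "(\<integral>\<^sup>+y. ennreal (laguerre_kernel \<alpha> s x y * laguerre_kernel \<alpha> r y z) \<partial>laguerre_measure \<alpha>) =
      (\<integral>\<^sup>+y. ennreal (\<Prod>i\<in>UNIV. (\<lambda>i y. laguerre_kernel_1 (\<alpha> $ i) s (x $ i) y * laguerre_kernel_1 (\<alpha> $ i) r y (z $ i)) i (y $ i)) \<partial>laguerre_measure \<alpha>)"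
      unfolding laguerre_kernel_prod by (simp add: prod.distrib)
    also have "\<dots> = (\<Prod>i\<in>UNIV. ennreal (laguerre_kernel_1 (\<alpha> $ i) (s + r) (x $ i) (z $ i)))"
      using \<alpha> pos[OF x] pos[OF z] s r
      by (subst nn_integral_laguerre_prod)
        (auto intro!: mult_nonneg_nonneg laguerre_kernel_1_nonneg simp: nn_integral_laguerre_kernel_1_mult)
    also have "\<dots> = ennreal (laguerre_kernel \<alpha> (s + r) x z)"
      unfolding laguerre_kernel_prod using \<alpha> pos[OF x] pos[OF z] s r
      by (intro prod_ennreal) (auto intro!: laguerre_kernel_1_nonneg)
    finally show "(\<integral>\<^sup>+y. ennreal (laguerre_kernel \<alpha> s x y * laguerre_kernel \<alpha> r y z) \<partial>laguerre_measure \<alpha>) = ennreal (laguerre_kernel \<alpha> (s + r) x z)" .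
  qed
qed

text \<open>The weight is strictly positive on the orthant, so no null set is gained or
  lost.\<close>

lemma AE_laguerre_measure:
  fixes \<alpha> :: "real^'d"
  assumes \<alpha>: "\<And>i. \<alpha> $ i > -1"
  shows "(AE x in laguerre_measure \<alpha>. P x) \<longleftrightarrow> (AE x in orthant_lborel. P x)"
proof -
  have "(AE x in laguerre_measure \<alpha>. P x) \<longleftrightarrow> (AE x in orthant_lborel. 0 < ennreal (\<Prod>i\<in>UNIV. laguerre_density (\<alpha> $ i) (x $ i)) \<longrightarrow> P x)"
    unfolding laguerre_measure_def laguerre_weight_eq
    by (intro AE_density measurable_compose[OF _ measurable_ennreal] borel_measurable_orthant_lborel) measurable
  also have "\<dots> \<longleftrightarrow> (AE x in orthant_lborel. P x)"
  proof (intro AE_cong)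
    fix x :: "real^'d" assume "x \<in> space orthant_lborel"
    moreover have "0 < \<alpha> $ i + 1" for i using \<alpha>[of i] by simp
    ultimately have "(\<Prod>i\<in>UNIV. laguerre_density (\<alpha> $ i) (x $ i)) > 0"
      unfolding laguerre_density_def
      by (intro prod_pos ballI divide_pos_pos mult_pos_pos Gamma_real_pos)
        (auto simp: orthant_def less_imp_neq[THEN not_sym])
    then show "(0 < ennreal (\<Prod>i\<in>UNIV. laguerre_density (\<alpha> $ i) (x $ i)) \<longrightarrow> P x) \<longleftrightarrow> P x" by simp
  qed
  finally show ?thesis .
qed

section \<open>The essential supremum norm on the orthant\<close>

lemma Linf_norm_le_iff:
  assumes "g \<in> borel_measurable orthant_lborel"
  shows "Linf_norm g \<le> ereal B \<longleftrightarrow> (AE x in orthant_lborel. norm (g x) \<le> B)"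
proof
  assume "Linf_norm g \<le> ereal B"
  then show "AE x in orthant_lborel. norm (g x) \<le> B"
    using esssup_AE[of "\<lambda>x. ereal (norm (g x))" orthant_lborel]
    unfolding Linf_norm_def by (auto elim!: eventually_mono dest: order_trans)
next
  assume "AE x in orthant_lborel. norm (g x) \<le> B"
  then show "Linf_norm g \<le> ereal B"
    unfolding Linf_norm_def using assms by (intro esssup_I) auto
qed

text \<open>An essential supremum over a null measure could be negative; here the orthant contains
  the open unit cube, which has positive measure.\<close>

lemma Linf_norm_nonneg: "0 \<le> Linf_norm (g :: real^'d \<Rightarrow> complex)"
proof (rule ccontr)
  assume "\<not> 0 \<le> Linf_norm g"
  then have neg: "Linf_norm g < 0" by simp
  have "AE x in orthant_lborel. ereal (norm (g x)) \<le> Linf_norm g"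
    unfolding Linf_norm_def by (rule esssup_AE)
  then have "AE x::real^'d in orthant_lborel. False"
  proof (rule eventually_mono)
    fix x assume "ereal (norm (g x)) \<le> Linf_norm g"
    then have "ereal (norm (g x)) < 0" using neg by (rule order_le_less_trans)
    then show False by simp
  qed
  then have "emeasure orthant_lborel (orthant :: (real^'d) set) = 0"
    using ae_filter_eq_bot_iff[of "orthant_lborel :: (real^'d) measure"] by (simp add: trivial_limit_def)
  moreover have "emeasure orthant_lborel (orthant :: (real^'d) set) = emeasure lborel (orthant :: (real^'d) set)"
    unfolding orthant_lborel_def by (subst emeasure_restrict_space) auto
  moreover have "emeasure lborel (box 0 1 :: (real^'d) set) \<le> emeasure lborel (orthant :: (real^'d) set)"
    by (intro emeasure_mono) (auto simp: orthant_def mem_box_cart)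
  moreover have "emeasure lborel (box 0 1 :: (real^'d) set) > 0"
  proof -
    have "(1::real^'d) \<bullet> b = 1" if "b \<in> Basis" for b
      using that by (auto simp: Basis_vec_def inner_axis)
    then show ?thesis by (simp add: emeasure_lborel_box_eq)
  qed
  ultimately show False by simp
qed

section \<open>Lipschitz bounds for the Poisson-Laguerre semigroup\<close>

lemma lipschitz_bound_nonneg:
  assumes "lipschitz_bound \<alpha> \<beta> k f A"
  shows "A \<ge> 0"
proof -
  have "Linf_norm (poisson_laguerre_deriv k \<alpha> 1 f) \<le> ereal A"
    using assms[unfolded lipschitz_bound_def, rule_format, of 1] by simp
  then have "0 \<le> ereal A" using Linf_norm_nonneg order_trans by blast
  then show ?thesis by simp
qed

text \<open>The admissible constants form a closed set bounded below by 0, so \<^const>\<open>lipschitz_const\<close> is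
  not a junk value.\<close>

lemma lipschitz_const:
  assumes A: "lipschitz_bound \<alpha> \<beta> k f A"
  shows "lipschitz_bound \<alpha> \<beta> k f (lipschitz_const \<alpha> \<beta> k f)"
    and "lipschitz_const \<alpha> \<beta> k f \<le> A"
proof -
  define S where "S = {A. lipschitz_bound \<alpha> \<beta> k f A}"
  have bdd: "bdd_below S" unfolding S_def by (intro bdd_belowI[of _ 0]) (auto dest: lipschitz_bound_nonneg)
  have ne: "S \<noteq> {}" using A by (auto simp: S_def)
  have "lipschitz_bound \<alpha> \<beta> k f (Inf S)"
    unfolding lipschitz_bound_def
  proof (intro allI impI)
    fix t :: real assume t: "t > 0"
    let ?N = "Linf_norm (poisson_laguerre_deriv k \<alpha> t f)" and ?p = "t powr (- real k + \<beta>)"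
    have p: "?p > 0" using t by simp
    have le: "?N \<le> ereal (a * ?p)" if "a \<in> S" for a
      using that t by (simp add: S_def lipschitz_bound_def)
    obtain n where n: "?N = ereal n"
      using le[of A] A Linf_norm_nonneg[of "poisson_laguerre_deriv k \<alpha> t f"] by (cases ?N) (auto simp: S_def)
    \<comment> \<open>For fixed \<open>t\<close>, the norm divided by the power is a lower bound of
      \<open>S\<close>, hence at most the infimum. This makes the infimum itself admissible.\<close>
    have "n / ?p \<le> Inf S"
      using le p by (intro cInf_greatest[OF ne]) (simp add: n divide_le_eq)
    then show "?N \<le> ereal (Inf S * ?p)" using p by (simp add: n divide_le_eq)
  qed
  moreover have "Inf S \<le> a" if "lipschitz_bound \<alpha> \<beta> k f a" for a
    using that bdd by (intro cInf_lower) (simp_all add: S_def)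
  ultimately have "lipschitz_const \<alpha> \<beta> k f = Inf S"
    unfolding lipschitz_const_def by (rule Least_equality)
  with \<open>lipschitz_bound \<alpha> \<beta> k f (Inf S)\<close> \<open>\<And>a. lipschitz_bound \<alpha> \<beta> k f a \<Longrightarrow> Inf S \<le> a\<close> A
  show "lipschitz_bound \<alpha> \<beta> k f (lipschitz_const \<alpha> \<beta> k f)" "lipschitz_const \<alpha> \<beta> k f \<le> A" by auto
qed

lemma bounded_by_Linf:
  fixes \<alpha> :: "real^'d"
  assumes \<alpha>: "\<And>i. \<alpha> $ i > -1" and f: "f \<in> Linf"
  obtains B where "markov_kernel.bounded_by (laguerre_measure \<alpha>) B f"
proof -
  interpret markov_kernel "laguerre_measure \<alpha>" "laguerre_kernel \<alpha>"
    by (rule markov_kernel_laguerre[OF \<alpha>])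
  have f_meas: "f \<in> borel_measurable orthant_lborel" and "Linf_norm f < \<infinity>"
    using f by (auto simp: Linf_def)
  then obtain B where B: "Linf_norm f = ereal B"
    using Linf_norm_nonneg[of f] by (cases "Linf_norm f") auto
  then have "AE x in orthant_lborel. norm (f x) \<le> B"
    using Linf_norm_le_iff[OF f_meas, of B] by simp
  then have "bounded_by B f"
    using f_meas unfolding bounded_by_def AE_laguerre_measure[OF \<alpha>]
    by (simp add: measurable_cong_sets[OF sets_laguerre_measure refl])
  then show ?thesis by (rule that)
qed

text \<open>\<open>vector_derivative\<close> is total, so an iterated derivative carries no evidence
  of differentiability. The induction therefore identifies each iterate on the whole open half-line
  of positive times before differentiating again.\<close>

lemma poisson_laguerre_deriv_eq:
  fixes \<alpha> :: "real^'d"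
  assumes \<alpha>: "\<And>i. \<alpha> $ i > -1" and f: "markov_kernel.bounded_by (laguerre_measure \<alpha>) B f"
    and t: "t > 0" and x: "x \<in> orthant"
  shows "poisson_laguerre_deriv k \<alpha> t f x =
    markov_kernel.poisson (laguerre_measure \<alpha>) (laguerre_kernel \<alpha>) k t f x"
proof -
  interpret markov_kernel "laguerre_measure \<alpha>" "laguerre_kernel \<alpha>"
    by (rule markov_kernel_laguerre[OF \<alpha>])
  have x': "x \<in> space (laguerre_measure \<alpha>)" using x by simp
  have base: "poisson_laguerre \<alpha> t f x = poisson 0 t f x" if t: "t > 0" for t
  proof -
    have "indicator {0<..} s *\<^sub>R ((t / (2 * sqrt pi) * exp (- (t\<^sup>2 / (4 * s))) / s powr (3 / 2)) *\<^sub>R laguerre_semigroup \<alpha> s f x)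
      = eta 0 t s *\<^sub>R heat s f x" for s
    proof (cases "s > 0")
      case True
      have "s powr (3 / 2) = s * sqrt s"
        using True powr_add[of s 1 "1/2"] by (simp add: powr_half_sqrt)
      then show ?thesis
        using True t by (simp add: eta_0 heat_def laguerre_semigroup_def)
    qed simp
    then show ?thesis
      unfolding poisson_laguerre_def poisson_def set_lebesgue_integral_def by (simp only:)
  qed
  have "((\<lambda>u s. vector_derivative u (at s)) ^^ k) (\<lambda>s. poisson_laguerre \<alpha> s f x) t = poisson k t f x"
    using t
  proof (induction k arbitrary: t)
    case 0
    then show ?case by (simp add: base)
  next
    case (Suc k)
    have "(((\<lambda>u s. vector_derivative u (at s)) ^^ k) (\<lambda>s. poisson_laguerre \<alpha> s f x) has_vector_derivative poisson (Suc k) t f x) (at t)"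
      by (rule has_vector_derivative_transform_within_open[OF poisson_has_vector_derivative[OF Suc.prems f x'], of "{0<..}"])
        (use Suc in auto)
    then show ?case by (simp add: vector_derivative_at)
  qed
  then show ?thesis by (simp add: poisson_laguerre_deriv_def)
qed

text \<open>Besides the equality of derivatives, this needs their measurability in the space
  variable, since otherwise the essential supremum would be infinite by convention.\<close>

lemma lipschitz_bound_iff:
  fixes \<alpha> :: "real^'d"
  assumes \<alpha>: "\<And>i. \<alpha> $ i > -1" and f: "markov_kernel.bounded_by (laguerre_measure \<alpha>) B f"
  shows "lipschitz_bound \<alpha> \<beta> k f A \<longleftrightarrow>
    markov_kernel.poisson_bound (laguerre_measure \<alpha>) (laguerre_kernel \<alpha>) \<beta> k f A"
proof -
  interpret markov_kernel "laguerre_measure \<alpha>" "laguerre_kernel \<alpha>"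
    by (rule markov_kernel_laguerre[OF \<alpha>])
  have [measurable]: "f \<in> borel_measurable (laguerre_measure \<alpha>)" using f by (simp add: bounded_by_def)
  have "Linf_norm (poisson_laguerre_deriv k \<alpha> t f) \<le> ereal C \<longleftrightarrow> (AE x in laguerre_measure \<alpha>. norm (poisson k t f x) \<le> C)"
    if t: "t > 0" for t C
  proof -
    have eq: "poisson_laguerre_deriv k \<alpha> t f x = poisson k t f x" if "x \<in> space orthant_lborel" for x
      using that by (intro poisson_laguerre_deriv_eq[OF \<alpha> f t]) simp
    have "poisson k t f \<in> borel_measurable (laguerre_measure \<alpha>)" by measurable
    then have "poisson k t f \<in> borel_measurable orthant_lborel"
      by (simp add: measurable_cong_sets[OF sets_laguerre_measure refl])
    then have meas: "poisson_laguerre_deriv k \<alpha> t f \<in> borel_measurable orthant_lborel"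
      by (rule measurable_cong[THEN iffD2, rotated]) (rule eq)
    show ?thesis
      unfolding AE_laguerre_measure[OF \<alpha>] Linf_norm_le_iff[OF meas]
      by (intro AE_cong) (simp add: eq)
  qed
  then show ?thesis by (auto simp: lipschitz_bound_def poisson_bound_def)
qed

theorem proposition3p1:
  fixes \<alpha> :: "real^'d" and \<beta> :: real and k l :: nat
  assumes "\<forall>i. \<alpha> $ i > - 1 / 2" and "\<beta> > 0" and "real k > \<beta>" and "real l > \<beta>"
  shows "(\<forall>f\<in>Linf. (\<exists>A. lipschitz_bound \<alpha> \<beta> k f A) \<longleftrightarrow> (\<exists>A. lipschitz_bound \<alpha> \<beta> l f A)) \<and>
    (\<exists>C>0. \<forall>f\<in>Linf. (\<exists>A. lipschitz_bound \<alpha> \<beta> k f A) \<longrightarrow>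
       lipschitz_const \<alpha> \<beta> k f \<le> C * lipschitz_const \<alpha> \<beta> l f \<and>
       lipschitz_const \<alpha> \<beta> l f \<le> C * lipschitz_const \<alpha> \<beta> k f)"
proof -
  have \<alpha>: "\<alpha> $ i > -1" for i using assms(1)[rule_format, of i] by simp
  interpret markov_kernel "laguerre_measure \<alpha>" "laguerre_kernel \<alpha>"
    by (rule markov_kernel_laguerre[OF \<alpha>])
  \<comment> \<open>Each \<open>f\<close> brings its own bound \<open>B\<close>, but
    \<open>C\<close> is fixed beforehand. Using this for both orders of the pair gives the
    equivalence as well as the two comparisons.\<close>
  have transfer: "\<exists>C>0. \<forall>f\<in>Linf. \<forall>A. lipschitz_bound \<alpha> \<beta> m f A \<longrightarrow> lipschitz_bound \<alpha> \<beta> n f (C * A)"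
    if mn: "real m > \<beta>" "real n > \<beta>" for m n
  proof -
    obtain C where C: "C > 0" "\<And>B f A. bounded_by B f \<Longrightarrow> poisson_bound \<beta> m f A \<Longrightarrow> poisson_bound \<beta> n f (C * A)"
      using poisson_bound_transfer[OF assms(2) mn] by blast
    have "lipschitz_bound \<alpha> \<beta> n f (C * A)" if "f \<in> Linf" and A: "lipschitz_bound \<alpha> \<beta> m f A" for f A
    proof -
      obtain B where B: "bounded_by B f" using bounded_by_Linf[OF \<alpha> \<open>f \<in> Linf\<close>] by blast
      show ?thesis using C(2)[OF B] A unfolding lipschitz_bound_iff[OF \<alpha> B] by blast
    qed
    with C(1) show ?thesis by blast
  qed
  obtain C where C: "C > 0" "\<And>f A. f \<in> Linf \<Longrightarrow> lipschitz_bound \<alpha> \<beta> k f A \<Longrightarrow> lipschitz_bound \<alpha> \<beta> l f (C * A)"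
    using transfer[OF assms(3,4)] by blast
  obtain D where D: "D > 0" "\<And>f A. f \<in> Linf \<Longrightarrow> lipschitz_bound \<alpha> \<beta> l f A \<Longrightarrow> lipschitz_bound \<alpha> \<beta> k f (D * A)"
    using transfer[OF assms(4,3)] by blast
  have "lipschitz_const \<alpha> \<beta> k f \<le> max C D * lipschitz_const \<alpha> \<beta> l f \<and>
       lipschitz_const \<alpha> \<beta> l f \<le> max C D * lipschitz_const \<alpha> \<beta> k f"
    if f: "f \<in> Linf" and A: "lipschitz_bound \<alpha> \<beta> k f A" for f A
  proof -
    \<comment> \<open>Both smallest constants are themselves admissible, so the transfer can be
      applied to them; minimality then yields the comparison, and their nonnegativity allows
      enlarging the factor to \<open>max C D\<close>.\<close>
    note k = lipschitz_const(1)[OF A] and l = lipschitz_const(1)[OF C(2)[OF f A]]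
    have "lipschitz_const \<alpha> \<beta> k f \<le> D * lipschitz_const \<alpha> \<beta> l f"
      by (rule lipschitz_const(2)[OF D(2)[OF f l]])
    also have "\<dots> \<le> max C D * lipschitz_const \<alpha> \<beta> l f"
      using lipschitz_bound_nonneg[OF l] by (intro mult_right_mono) auto
    finally have "lipschitz_const \<alpha> \<beta> k f \<le> max C D * lipschitz_const \<alpha> \<beta> l f" .
    moreover have "lipschitz_const \<alpha> \<beta> l f \<le> C * lipschitz_const \<alpha> \<beta> k f"
      by (rule lipschitz_const(2)[OF C(2)[OF f k]])
    then have "lipschitz_const \<alpha> \<beta> l f \<le> max C D * lipschitz_const \<alpha> \<beta> k f"
      using lipschitz_bound_nonneg[OF k] by (elim order_trans) (intro mult_right_mono, auto)
    ultimately show ?thesis by blast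
  qed
  moreover have "max C D > 0" using C(1) by simp
  ultimately show ?thesis using C(2) D(2) by blast
qed

end
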